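(* Let $\mathcal{M}$ be an $n$-dimensional smooth complete Riemannian manifold, let $f\colon\mathcal{M}\to\mathbb{R}$, $h=(h_1,\dots,h_s)\colon\mathcal{M}\to\mathbb{R}^s$ and $g=(g_1,\dots,g_m)\colon\mathcal{M}\to\mathbb{R}^m$ be continuously differentiable, and let $\Omega=\{q\in\mathcal{M}: h(q)=0,\ g(q)\le 0\}$. Let $p\in\Omega$ be a PAKKT point of the problem of minimizing $f$ over $\Omega$, with associated primal sequence $(p^k)_{k\in\mathbb{N}}$ and dual sequence $(\lambda^k,\mu^k)_{k\in\mathbb{N}}$. Assume that $p$ satisfies the quasinormality constraint qualification (QN). Then $(\lambda^k,\mu^k)_{k\in\mathbb{N}}$ is a bounded sequence. In particular, $p$ satisfies the KKT conditions and any limit point of $(\lambda^k,\mu^k)_{k\in\mathbb{N}}$ is a Lagrange multiplier associated with $p$.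
   Context: $d$ is the Riemannian distance, $B_\epsilon(p)=\{q\in\mathcal{M}: d(p,q)<\epsilon\}$, and $\operatorname{grad}$ is the Riemannian gradient. For $p\in\Omega$, $\mathcal{A}(p)=\{j: g_j(p)=0\}$. The Lagrangian is $L(q,\lambda,\mu)=f(q)+\sum_{i=1}^s\lambda_ih_i(q)+\sum_{j=1}^m\mu_jg_j(q)$, and $\operatorname{grad}L$ is its gradient with respect to $q$. KKT conditions at $p\in\Omega$: there is $(\lambda,\mu)\in\mathbb{R}^s\times\mathbb{R}^m_+$ with $\operatorname{grad}L(p,\lambda,\mu)=0$ and $\mu_j=0$ for all $j\notin\mathcal{A}(p)$; such $(\lambda,\mu)$ is called a Lagrange multiplier associated with $p$. PAKKT (Positive-Approximate-KKT) point: $p\in\Omega$ for which there are sequences $(p^k)_{k\in\mathbb{N}}\subset\mathcal{M}$ (associated primal sequence) and $(\lambda^k)_{k\in\mathbb{N}}\subset\mathbb{R}^s$, $(\mu^k)_{k\in\mathbb{N}}\subset\mathbb{R}^m_+$ (with $(\lambda^k,\mu^k)_{k\in\mathbb{N}}$ the associated dual sequence) such that (i) $\lim_{k\to\infty}p^k=p$; (ii) $\lim_{k\to\infty}\|\operatorname{grad}L(p^k,\lambda^k,\mu^k)\|=0$; (iii) $\mu_j^k=0$ for all $j\notin\mathcal{A}(p)$ and sufficiently large $k$; (iv) if $\gamma_k:=\|(1,\lambda^k,\mu^k)\|_\infty\to+\infty$, then it holds: $\lim_{k\to\infty}|\lambda_i^k|/\gamma_k>0$ implies $\lambda_i^kh_i(p^k)>0$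 for all $k\in\mathbb{N}$; and $\lim_{k\to\infty}\mu_j^k/\gamma_k>0$ implies $\mu_j^kg_j(p^k)>0$ for all $k\in\mathbb{N}$. QN: $p\in\Omega$ satisfies QN if there are no $\lambda\in\mathbb{R}^s$ and $\mu\in\mathbb{R}^m_+$ such that (i) $\sum_{i=1}^s\lambda_i\operatorname{grad}h_i(p)+\sum_{j\in\mathcal{A}(p)}\mu_j\operatorname{grad}g_j(p)=0$; (ii) $\mu_j=0$ for all $j\notin\mathcal{A}(p)$ and $(\lambda,\mu)\ne0$; (iii) for all $\epsilon>0$ there is $q\in B_\epsilon(p)$ such that $\lambda_ih_i(q)>0$ for all $i\in\{1,\dots,s\}$ with $\lambda_i\ne0$ and $\mu_jg_j(q)>0$ for all $j\in\mathcal{A}(p)$ with $\mu_j>0$.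
   Formalization: In the definition of a PAKKT point, condition (iv) is required not only for the whole sequence but also for every subsequence after dropping finitely many terms; with (iv) read literally, non-convergent ratios make it void and the claim fails. *)

theory Defs
  imports "HOL-Analysis.Analysis" "HOL-Library.Function_Algebras"
begin

section \<open>Smooth maps between Euclidean spaces\<close>

text \<open>Being of class \<open>C^k\<close> on an open set, by iterating directional derivatives. In finite
  dimension this is the usual notion.\<close>

fun Ck_on :: "nat \<Rightarrow> ('e::euclidean_space \<Rightarrow> 'b::euclidean_space) \<Rightarrow> 'e set \<Rightarrow> bool" where
  "Ck_on 0 F S \<longleftrightarrow> continuous_on S F"
| "Ck_on (Suc k) F S \<longleftrightarrow>
     (\<forall>x\<in>S. F differentiable (at x)) \<and> (\<forall>v. Ck_on k (\<lambda>x. frechet_derivative F (at x) v) S)"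

definition smooth_on :: "('e::euclidean_space \<Rightarrow> 'b::euclidean_space) \<Rightarrow> 'e set \<Rightarrow> bool" where
  "smooth_on F S \<longleftrightarrow> (\<forall>k. Ck_on k F S)"


section \<open>Smooth manifolds\<close>

text \<open>The manifold is a whole type \<open>'a\<close>, Hausdorff and second countable, with an atlas of charts
  into \<open>real ^ 'n\<close>; its dimension is \<open>CARD('n)\<close>. Connectedness is not assumed.\<close>

type_synonym ('a, 'n) chart = "'a set \<times> ('a \<Rightarrow> real ^ 'n)"

abbreviation dom_of :: "('a, 'n) chart \<Rightarrow> 'a set" where
  "dom_of c \<equiv> fst c"

abbreviation coord :: "('a, 'n) chart \<Rightarrow> 'a \<Rightarrow> real ^ 'n" where
  "coord c \<equiv> snd c"

definition image_of :: "('a, 'n) chart \<Rightarrow> (real ^ 'n) set" where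
  "image_of c = coord c ` dom_of c"

definition param :: "('a, 'n) chart \<Rightarrow> real ^ 'n \<Rightarrow> 'a" where
  "param c = inv_into (dom_of c) (coord c)"

definition is_chart :: "('a::topological_space, 'n::finite) chart \<Rightarrow> bool" where
  "is_chart c \<longleftrightarrow> open (dom_of c) \<and> open (image_of c) \<and>
     homeomorphism (dom_of c) (image_of c) (coord c) (param c)"

definition smooth_atlas :: "('a::topological_space, 'n::finite) chart set \<Rightarrow> bool" where
  "smooth_atlas A \<longleftrightarrow> (\<forall>c\<in>A. is_chart c) \<and> (\<Union>c\<in>A. dom_of c) = UNIV \<and>
     (\<forall>c\<in>A. \<forall>d\<in>A. smooth_on (coord d \<circ> param c) (coord c ` (dom_of c \<inter> dom_of d)))"

definition charts_at :: "('a, 'n) chart set \<Rightarrow> 'a \<Rightarrow> ('a, 'n) chart set" where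
  "charts_at A p = {c \<in> A. p \<in> dom_of c}"

definition C1_function :: "('a, 'n::finite) chart set \<Rightarrow> ('a \<Rightarrow> real) \<Rightarrow> bool" where
  "C1_function A F \<longleftrightarrow> (\<forall>c\<in>A. Ck_on 1 (F \<circ> param c) (image_of c))"


section \<open>Tangent spaces\<close>

text \<open>A tangent vector at \<open>p\<close> is the family of its components in the charts around \<open>p\<close>, related by
  the Jacobians of the transition maps. It is set to \<open>0\<close> on all other charts, so that equal tangent
  vectors are equal functions. Sums and zero are those of functions (\<open>Function_Algebras\<close>).\<close>

type_synonym ('a, 'n) tvec = "('a, 'n) chart \<Rightarrow> real ^ 'n"

definition tscale :: "real \<Rightarrow> ('a, 'n::finite) tvec \<Rightarrow> ('a, 'n) tvec" (infixr \<open>*\<^sub>T\<close> 75) where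
  "r *\<^sub>T v = (\<lambda>c. r *\<^sub>R v c)"

definition tangent_space :: "('a, 'n::finite) chart set \<Rightarrow> 'a \<Rightarrow> ('a, 'n) tvec set" where
  "tangent_space A p =
     {v. (\<forall>c\<in>charts_at A p. \<forall>d\<in>charts_at A p.
            v d = frechet_derivative (coord d \<circ> param c) (at (coord c p)) (v c)) \<and>
         (\<forall>c. c \<notin> charts_at A p \<longrightarrow> v c = 0)}"

text \<open>The tangent vector at \<open>p\<close> whose components in the chart \<open>c\<close> are \<open>a\<close>.\<close>

definition coord_tvec ::
  "('a, 'n::finite) chart set \<Rightarrow> ('a, 'n) chart \<Rightarrow> 'a \<Rightarrow> real ^ 'n \<Rightarrow> ('a, 'n) tvec" where
  "coord_tvec A c p a =
     (\<lambda>d. if d \<in> charts_at A p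
          then frechet_derivative (coord d \<circ> param c) (at (coord c p)) a else 0)"

text \<open>The differential of a differentiable function does not depend on the chart chosen.\<close>

definition differential ::
  "('a, 'n::finite) chart set \<Rightarrow> ('a \<Rightarrow> real) \<Rightarrow> 'a \<Rightarrow> ('a, 'n) tvec \<Rightarrow> real" where
  "differential A F p v =
     (let c = (SOME c. c \<in> charts_at A p)
      in frechet_derivative (F \<circ> param c) (at (coord c p)) (v c))"


section \<open>Riemannian metrics, gradients and the Riemannian distance\<close>

text \<open>A metric \<open>G\<close> gives an inner product \<open>G p\<close> on each tangent space; its values outside the
  tangent space at \<open>p\<close> are irrelevant.\<close>

type_synonym ('a, 'n) metric_field = "'a \<Rightarrow> ('a, 'n) tvec \<Rightarrow> ('a, 'n) tvec \<Rightarrow> real"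

definition inner_product_on :: "('a, 'n::finite) tvec set \<Rightarrow>
    (('a, 'n) tvec \<Rightarrow> ('a, 'n) tvec \<Rightarrow> real) \<Rightarrow> bool" where
  "inner_product_on T ip \<longleftrightarrow>
     (\<forall>u\<in>T. \<forall>v\<in>T. ip u v = ip v u) \<and>
     (\<forall>u\<in>T. \<forall>v\<in>T. \<forall>w\<in>T. ip (u + v) w = ip u w + ip v w) \<and>
     (\<forall>r. \<forall>u\<in>T. \<forall>v\<in>T. ip (r *\<^sub>T u) v = r * ip u v) \<and>
     (\<forall>u\<in>T. u \<noteq> 0 \<longrightarrow> ip u u > 0)"

definition riemannian_metric ::
  "('a, 'n::finite) chart set \<Rightarrow> ('a, 'n) metric_field \<Rightarrow> bool" where
  "riemannian_metric A G \<longleftrightarrow>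
     (\<forall>p. inner_product_on (tangent_space A p) (G p)) \<and>
     (\<forall>c\<in>A. \<forall>a b. smooth_on
        (\<lambda>x. G (param c x) (coord_tvec A c (param c x) a) (coord_tvec A c (param c x) b))
        (image_of c))"

definition tnorm :: "('a, 'n) metric_field \<Rightarrow> 'a \<Rightarrow> ('a, 'n) tvec \<Rightarrow> real" where
  "tnorm G p v = sqrt (G p v v)"

definition gradient :: "('a, 'n::finite) chart set \<Rightarrow> ('a, 'n) metric_field \<Rightarrow>
    ('a \<Rightarrow> real) \<Rightarrow> 'a \<Rightarrow> ('a, 'n) tvec" where
  "gradient A G F p =
     (THE v. v \<in> tangent_space A p \<and> (\<forall>w\<in>tangent_space A p. G p v w = differential A F p w))"

text \<open>As for the library's \<open>piecewise_C1_differentiable_on\<close>, nothing is required at the finitely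
  many exceptional parameters besides continuity. Should the speed fail to be integrable, the
  length below is infinite.\<close>

definition piecewise_C1_curve ::
  "('a::topological_space, 'n::finite) chart set \<Rightarrow> (real \<Rightarrow> 'a) \<Rightarrow> bool" where
  "piecewise_C1_curve A \<gamma> \<longleftrightarrow> path \<gamma> \<and>
     (\<exists>S. finite S \<and>
        (\<forall>c\<in>A. (coord c \<circ> \<gamma>) C1_differentiable_on {t \<in> {0..1} - S. \<gamma> t \<in> dom_of c}))"

definition velocity ::
  "('a, 'n::finite) chart set \<Rightarrow> (real \<Rightarrow> 'a) \<Rightarrow> real \<Rightarrow> ('a, 'n) tvec" where
  "velocity A \<gamma> t =
     (\<lambda>c. if c \<in> charts_at A (\<gamma> t) then vector_derivative (coord c \<circ> \<gamma>) (at t) else 0)"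

definition curve_length :: "('a, 'n::finite) chart set \<Rightarrow> ('a, 'n) metric_field \<Rightarrow>
    (real \<Rightarrow> 'a) \<Rightarrow> ennreal" where
  "curve_length A G \<gamma> = (\<integral>\<^sup>+ t\<in>{0..1}. ennreal (tnorm G (\<gamma> t) (velocity A \<gamma> t)) \<partial>lborel)"

text \<open>Extended-valued: the distance is \<open>\<infinity>\<close> between points of different connected components.\<close>

definition riem_dist :: "('a::topological_space, 'n::finite) chart set \<Rightarrow> ('a, 'n) metric_field \<Rightarrow>
    'a \<Rightarrow> 'a \<Rightarrow> ennreal" where
  "riem_dist A G p q =
     (INF \<gamma> \<in> {\<gamma>. piecewise_C1_curve A \<gamma> \<and> pathstart \<gamma> = p \<and> pathfinish \<gamma> = q}. curve_length A G \<gamma>)"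

definition riem_ball :: "('a::topological_space, 'n::finite) chart set \<Rightarrow> ('a, 'n) metric_field \<Rightarrow>
    'a \<Rightarrow> real \<Rightarrow> 'a set" where
  "riem_ball A G p \<epsilon> = {q. riem_dist A G p q < ennreal \<epsilon>}"

definition riem_complete ::
  "('a::topological_space, 'n::finite) chart set \<Rightarrow> ('a, 'n) metric_field \<Rightarrow> bool" where
  "riem_complete A G \<longleftrightarrow>
     (\<forall>X :: nat \<Rightarrow> 'a.
        (\<forall>\<epsilon>>0. \<exists>N. \<forall>k\<ge>N. \<forall>l\<ge>N. riem_dist A G (X k) (X l) < ennreal \<epsilon>) \<longrightarrow>
        (\<exists>x. (\<lambda>k. riem_dist A G (X k) x) \<longlonglongrightarrow> 0))"

definition complete_riemannian_manifold ::
  "('a::{t2_space, second_countable_topology}, 'n::finite) chart set \<Rightarrow>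
   ('a, 'n) metric_field \<Rightarrow> bool" where
  "complete_riemannian_manifold A G \<longleftrightarrow>
     smooth_atlas A \<and> riemannian_metric A G \<and> riem_complete A G"


section \<open>The optimization problem\<close>

text \<open>The constraints are \<open>h i\<close>, \<open>i \<in> {1..s}\<close>, and \<open>g j\<close>, \<open>j \<in> {1..m}\<close>; either family may be
  empty. Vectors of \<open>\<real>^s\<close> and \<open>\<real>^m\<close> are functions on \<open>nat\<close> of which only the values at the indices
  in \<open>{1..s}\<close> and \<open>{1..m}\<close> matter.\<close>

definition feasible_set ::
  "nat \<Rightarrow> (nat \<Rightarrow> 'a \<Rightarrow> real) \<Rightarrow> nat \<Rightarrow> (nat \<Rightarrow> 'a \<Rightarrow> real) \<Rightarrow> 'a set" where
  "feasible_set s h m g = {q. (\<forall>i\<in>{1..s}. h i q = 0) \<and> (\<forall>j\<in>{1..m}. g j q \<le> 0)}"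

definition active_set :: "nat \<Rightarrow> (nat \<Rightarrow> 'a \<Rightarrow> real) \<Rightarrow> 'a \<Rightarrow> nat set" where
  "active_set m g p = {j \<in> {1..m}. g j p = 0}"

definition lagrangian :: "('a \<Rightarrow> real) \<Rightarrow> nat \<Rightarrow> (nat \<Rightarrow> 'a \<Rightarrow> real) \<Rightarrow> nat \<Rightarrow> (nat \<Rightarrow> 'a \<Rightarrow> real) \<Rightarrow>
    (nat \<Rightarrow> real) \<Rightarrow> (nat \<Rightarrow> real) \<Rightarrow> 'a \<Rightarrow> real" where
  "lagrangian f s h m g lam mu q = f q + (\<Sum>i=1..s. lam i * h i q) + (\<Sum>j=1..m. mu j * g j q)"

definition lagrange_multiplier :: "('a, 'n::finite) chart set \<Rightarrow> ('a, 'n) metric_field \<Rightarrow>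
    ('a \<Rightarrow> real) \<Rightarrow> nat \<Rightarrow> (nat \<Rightarrow> 'a \<Rightarrow> real) \<Rightarrow> nat \<Rightarrow> (nat \<Rightarrow> 'a \<Rightarrow> real) \<Rightarrow>
    'a \<Rightarrow> (nat \<Rightarrow> real) \<Rightarrow> (nat \<Rightarrow> real) \<Rightarrow> bool" where
  "lagrange_multiplier A G f s h m g p lam mu \<longleftrightarrow>
     (\<forall>j\<in>{1..m}. mu j \<ge> 0) \<and>
     gradient A G (lagrangian f s h m g lam mu) p = 0 \<and>
     (\<forall>j\<in>{1..m} - active_set m g p. mu j = 0)"

definition KKT :: "('a, 'n::finite) chart set \<Rightarrow> ('a, 'n) metric_field \<Rightarrow>
    ('a \<Rightarrow> real) \<Rightarrow> nat \<Rightarrow> (nat \<Rightarrow> 'a \<Rightarrow> real) \<Rightarrow> nat \<Rightarrow> (nat \<Rightarrow> 'a \<Rightarrow> real) \<Rightarrow> 'a \<Rightarrow> bool" where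
  "KKT A G f s h m g p \<longleftrightarrow>
     p \<in> feasible_set s h m g \<and> (\<exists>lam mu. lagrange_multiplier A G f s h m g p lam mu)"

definition QN :: "('a::topological_space, 'n::finite) chart set \<Rightarrow> ('a, 'n) metric_field \<Rightarrow>
    nat \<Rightarrow> (nat \<Rightarrow> 'a \<Rightarrow> real) \<Rightarrow> nat \<Rightarrow> (nat \<Rightarrow> 'a \<Rightarrow> real) \<Rightarrow> 'a \<Rightarrow> bool" where
  "QN A G s h m g p \<longleftrightarrow>
     \<not> (\<exists>lam mu :: nat \<Rightarrow> real.
          (\<forall>j\<in>{1..m}. mu j \<ge> 0) \<and>
          (\<Sum>i=1..s. lam i *\<^sub>T gradient A G (h i) p) +
            (\<Sum>j\<in>active_set m g p. mu j *\<^sub>T gradient A G (g j) p) = 0 \<and>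
          (\<forall>j\<in>{1..m} - active_set m g p. mu j = 0) \<and>
          ((\<exists>i\<in>{1..s}. lam i \<noteq> 0) \<or> (\<exists>j\<in>{1..m}. mu j \<noteq> 0)) \<and>
          (\<forall>\<epsilon>>0. \<exists>q\<in>riem_ball A G p \<epsilon>.
             (\<forall>i\<in>{1..s}. lam i \<noteq> 0 \<longrightarrow> lam i * h i q > 0) \<and>
             (\<forall>j\<in>active_set m g p. mu j > 0 \<longrightarrow> mu j * g j q > 0)))"

text \<open>The maximum norm of \<open>(1, \<lambda>, \<mu>)\<close>.\<close>

definition max_norm1 :: "nat \<Rightarrow> nat \<Rightarrow> (nat \<Rightarrow> real) \<Rightarrow> (nat \<Rightarrow> real) \<Rightarrow> real" where
  "max_norm1 s m lam mu = Max ({1} \<union> (\<lambda>i. \<bar>lam i\<bar>) ` {1..s} \<union> (\<lambda>j. \<bar>mu j\<bar>) ` {1..m})"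

definition PAKKT_sign_condition :: "nat \<Rightarrow> (nat \<Rightarrow> 'a \<Rightarrow> real) \<Rightarrow> nat \<Rightarrow> (nat \<Rightarrow> 'a \<Rightarrow> real) \<Rightarrow>
    (nat \<Rightarrow> 'a) \<Rightarrow> (nat \<Rightarrow> nat \<Rightarrow> real) \<Rightarrow> (nat \<Rightarrow> nat \<Rightarrow> real) \<Rightarrow> bool" where
  "PAKKT_sign_condition s h m g ps lams mus \<longleftrightarrow>
     (let \<gamma> = (\<lambda>k. max_norm1 s m (lams k) (mus k)) in
      filterlim \<gamma> at_top sequentially \<longrightarrow>
        (\<forall>i\<in>{1..s}. (\<exists>l>0. (\<lambda>k. \<bar>lams k i\<bar> / \<gamma> k) \<longlonglongrightarrow> l) \<longrightarrow> (\<forall>k. lams k i * h i (ps k) > 0)) \<and>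
        (\<forall>j\<in>{1..m}. (\<exists>l>0. (\<lambda>k. mus k j / \<gamma> k) \<longlonglongrightarrow> l) \<longrightarrow> (\<forall>k. mus k j * g j (ps k) > 0)))"

text \<open>\<open>p\<close> is a PAKKT point with associated primal sequence \<open>ps\<close> and dual sequence \<open>(lams, mus)\<close>.

  The limits in the sign condition are read along subsequences too: besides the whole sequence,
  every subsequence has to satisfy it after finitely many terms are dropped. If the condition were
  imposed on the whole sequence only, it would be void for dual sequences that are unbounded without
  tending to infinity or whose normalized components oscillate, and quasinormality would neither
  bound the dual sequence nor give the KKT conditions. On \<open>\<real>\<close> at \<open>p = 0\<close>, take \<open>s = 0\<close>,
  \<open>g\<^sub>1(x) = g\<^sub>2(x) = - x^2\<close>, \<open>f(x) = x\<close>, \<open>\<mu>^k = (k, 0)\<close> for even and \<open>\<mu>^k = (0, k)\<close> for odd \<open>k\<close>, and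
  \<open>p^k = 1 / (2 k)\<close> (\<open>k \<ge> 1\<close>).
  The subsequence clause follows from the condition on the whole sequence if the
  \<open>max_norm1\<close>s are bounded, or if they tend to infinity and all normalized components converge.\<close>

definition PAKKT_point_with :: "('a::topological_space, 'n::finite) chart set \<Rightarrow>
    ('a, 'n) metric_field \<Rightarrow> ('a \<Rightarrow> real) \<Rightarrow> nat \<Rightarrow> (nat \<Rightarrow> 'a \<Rightarrow> real) \<Rightarrow> nat \<Rightarrow>
    (nat \<Rightarrow> 'a \<Rightarrow> real) \<Rightarrow> 'a \<Rightarrow> (nat \<Rightarrow> 'a) \<Rightarrow> (nat \<Rightarrow> nat \<Rightarrow> real) \<Rightarrow> (nat \<Rightarrow> nat \<Rightarrow> real) \<Rightarrow> bool" where
  "PAKKT_point_with A G f s h m g p ps lams mus \<longleftrightarrow>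
     p \<in> feasible_set s h m g \<and>
     (\<forall>k. \<forall>j\<in>{1..m}. mus k j \<ge> 0) \<and>
     ps \<longlonglongrightarrow> p \<and>
     (\<lambda>k. tnorm G (ps k) (gradient A G (lagrangian f s h m g (lams k) (mus k)) (ps k))) \<longlonglongrightarrow> 0 \<and>
     (\<forall>\<^sub>F k in sequentially. \<forall>j\<in>{1..m} - active_set m g p. mus k j = 0) \<and>
     PAKKT_sign_condition s h m g ps lams mus \<and>
     (\<forall>r. strict_mono r \<longrightarrow>
        (\<exists>N. PAKKT_sign_condition s h m g
               (\<lambda>k. ps (r (k + N))) (\<lambda>k. lams (r (k + N))) (\<lambda>k. mus (r (k + N)))))"

definition bounded_dual_seq ::
  "nat \<Rightarrow> nat \<Rightarrow> (nat \<Rightarrow> nat \<Rightarrow> real) \<Rightarrow> (nat \<Rightarrow> nat \<Rightarrow> real) \<Rightarrow> bool" where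
  "bounded_dual_seq s m lams mus \<longleftrightarrow>
     (\<exists>B. \<forall>k. (\<forall>i\<in>{1..s}. \<bar>lams k i\<bar> \<le> B) \<and> (\<forall>j\<in>{1..m}. \<bar>mus k j\<bar> \<le> B))"

definition dual_limit_point :: "nat \<Rightarrow> nat \<Rightarrow> (nat \<Rightarrow> nat \<Rightarrow> real) \<Rightarrow> (nat \<Rightarrow> nat \<Rightarrow> real) \<Rightarrow>
    (nat \<Rightarrow> real) \<Rightarrow> (nat \<Rightarrow> real) \<Rightarrow> bool" where
  "dual_limit_point s m lams mus lam mu \<longleftrightarrow>
     (\<exists>r :: nat \<Rightarrow> nat. strict_mono r \<and>
        (\<forall>i\<in>{1..s}. (\<lambda>k. lams (r k) i) \<longlonglongrightarrow> lam i) \<and>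
        (\<forall>j\<in>{1..m}. (\<lambda>k. mus (r k) j) \<longlonglongrightarrow> mu j))"

end

theory Submission
  imports Defs
begin

text \<open>Suppose the dual sequence were unbounded. Divide it by its maximum norms \<open>\<gamma>\<^sub>k\<close> and pass to a
  subsequence along which \<open>\<gamma>\<^sub>k \<rightarrow> \<infinity>\<close> and all the finitely many normalized multipliers converge, say
  to \<open>(\<alpha>, \<beta>)\<close> (\<open>unbounded_dual_seq_normalized_limit\<close>). Dividing the Lagrangian by \<open>\<gamma>\<^sub>k\<close> makes \<open>f\<close>
  disappear in the limit, so approximate stationarity leaves a vanishing combination of the
  constraint gradients with coefficients \<open>(\<alpha>, \<beta>)\<close>, and these are not all zero because the vectors
  \<open>(1, \<lambda>\<^sup>k, \<mu>\<^sup>k) / \<gamma>\<^sub>k\<close> have norm one while their first entry vanishes in the limit.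
  A multiplier eventually has the sign of its nonzero normalized limit, so the sign condition turns
  into \<open>\<alpha>\<^sub>i h\<^sub>i(p\<^sup>k) > 0\<close> where \<open>\<alpha>\<^sub>i \<noteq> 0\<close>, and \<open>\<beta>\<^sub>j g\<^sub>j(p\<^sup>k) > 0\<close> where \<open>\<beta>\<^sub>j > 0\<close>; as \<open>p\<^sup>k\<close> enters every
  Riemannian ball around \<open>p\<close>, the pair \<open>(\<alpha>, \<beta>)\<close> is one that quasinormality excludes
  (\<open>QN_imp_bounded_dual_seq\<close>). A bounded dual sequence has limit points, and passing to the limit in
  approximate stationarity, now without dividing, shows that each of them is a Lagrange multiplier
  (\<open>dual_limit_point_is_multiplier\<close>).

  Both limits are instances of \<open>scaled_stationarity_limit\<close>. Since the gradients at the points \<open>p\<^sup>k\<close>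
  lie in different tangent spaces, the limit is taken of the numbers \<open>dL(W)\<close> instead, where \<open>W\<close> is
  the vector field with constant components in one chart around \<open>p\<close>: by the Cauchy-Schwarz
  inequality \<open>dL(W)\<close> is at most \<open>\<parallel>grad L\<parallel> \<parallel>W\<parallel>\<close>, and \<open>\<parallel>W\<parallel>\<close> is continuous. Gradients are thus only
  seen through differentials, which needs their existence and uniqueness
  (\<open>Riesz_tangent_space\<close>), and the distance only through the fact that its balls are neighbourhoods
  (\<open>eventually_in_riem_ball\<close>).\<close>


section \<open>Changes of charts and tangent vectors\<close>

locale atlas =
  fixes A :: "('a::t2_space, 'n::finite) chart set"
  assumes smooth_atlas: "smooth_atlas A"
begin

lemma chart_homeomorphism:
  assumes "c \<in> A"
  shows "homeomorphism (dom_of c) (image_of c) (coord c) (param c)"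
    and "open (dom_of c)" and "open (image_of c)"
  using assms smooth_atlas by (auto simp: smooth_atlas_def is_chart_def)

lemma charts_atD: "c \<in> charts_at A q \<Longrightarrow> c \<in> A \<and> q \<in> dom_of c"
  by (simp add: charts_at_def)

lemma charts_at_nonempty: "\<exists>c. c \<in> charts_at A q"
proof -
  have "q \<in> (\<Union>c\<in>A. dom_of c)"
    using smooth_atlas by (simp add: smooth_atlas_def)
  then show ?thesis by (auto simp: charts_at_def)
qed

lemma param_coord: "c \<in> A \<Longrightarrow> q \<in> dom_of c \<Longrightarrow> param c (coord c q) = q"
  using chart_homeomorphism(1) homeomorphism_apply1 by metis

lemma coord_param: "c \<in> A \<Longrightarrow> x \<in> image_of c \<Longrightarrow> coord c (param c x) = x"
  using chart_homeomorphism(1) homeomorphism_apply2 by metis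

lemma param_in_dom: "c \<in> A \<Longrightarrow> x \<in> image_of c \<Longrightarrow> param c x \<in> dom_of c"
  using chart_homeomorphism(1) homeomorphism_image2 by blast

lemma coord_in_image: "c \<in> charts_at A q \<Longrightarrow> coord c q \<in> image_of c"
  by (simp add: image_of_def charts_at_def)

lemma open_overlap:
  assumes "c \<in> A" "d \<in> A"
  shows "open (coord c ` (dom_of c \<inter> dom_of d))"
proof -
  have "openin (top_of_set (dom_of c)) (dom_of c \<inter> dom_of d)"
    using chart_homeomorphism(2)[OF assms(2)] by (simp add: openin_open_Int)
  then have "openin (top_of_set (image_of c)) (coord c ` (dom_of c \<inter> dom_of d))"
    using homeomorphism_imp_open_map[OF chart_homeomorphism(1)[OF assms(1)]] by blast
  then show ?thesis
    using chart_homeomorphism(3)[OF assms(1)] openin_open_trans by blast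
qed

lemma overlapI:
  assumes "c \<in> A" "x \<in> image_of c" "param c x \<in> dom_of d"
  shows "x \<in> coord c ` (dom_of c \<inter> dom_of d)"
  using assms by (metis IntI coord_param image_eqI param_in_dom)

lemma transition_C1:
  assumes "c \<in> A" "d \<in> A" and x: "x \<in> coord c ` (dom_of c \<inter> dom_of d)"
  shows "((coord d \<circ> param c) has_derivative frechet_derivative (coord d \<circ> param c) (at x)) (at x)"
    and "continuous_on (coord c ` (dom_of c \<inter> dom_of d))
           (\<lambda>x. frechet_derivative (coord d \<circ> param c) (at x) v)"
proof -
  have "smooth_on (coord d \<circ> param c) (coord c ` (dom_of c \<inter> dom_of d))"
    using smooth_atlas assms(1,2) by (auto simp: smooth_atlas_def)
  then have C: "Ck_on (Suc 0) (coord d \<circ> param c) (coord c ` (dom_of c \<inter> dom_of d))"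
    by (simp only: smooth_on_def)
  show "((coord d \<circ> param c) has_derivative frechet_derivative (coord d \<circ> param c) (at x)) (at x)"
    using C x by (simp only: Ck_on.simps frechet_derivative_works)
  show "continuous_on (coord c ` (dom_of c \<inter> dom_of d))
           (\<lambda>x. frechet_derivative (coord d \<circ> param c) (at x) v)"
    using C by simp
qed

lemma transition_derivative:
  assumes "c \<in> charts_at A q" "d \<in> charts_at A q"
  shows "((coord d \<circ> param c) has_derivative
           frechet_derivative (coord d \<circ> param c) (at (coord c q))) (at (coord c q))"
  using assms by (intro transition_C1(1)) (auto dest: charts_atD)

text \<open>Every compatibility statement below, for tangent vectors as well as for differentials, is an
  instance of the chain rule for \<open>F \<circ> param c = (F \<circ> param d) \<circ> (coord d \<circ> param c)\<close>, which holds
  near the point only: away from the overlap of the charts, \<^const>\<open>param\<close> and \<^const>\<open>coord\<close>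
  take arbitrary values.\<close>

lemma chain_rule_charts:
  fixes F :: "'a \<Rightarrow> 'b::real_normed_vector"
  assumes c: "c \<in> charts_at A q" and d: "d \<in> charts_at A q"
    and F: "((F \<circ> param d) has_derivative D) (at (coord d q))"
  shows "((F \<circ> param c) has_derivative
           (\<lambda>v. D (frechet_derivative (coord d \<circ> param c) (at (coord c q)) v))) (at (coord c q))"
proof (rule has_derivative_transform_within_open)
  let ?S = "coord c ` (dom_of c \<inter> dom_of d)"
  have cd: "c \<in> A" "q \<in> dom_of c" "d \<in> A" "q \<in> dom_of d"
    using c d by (auto dest: charts_atD)
  have F': "((F \<circ> param d) has_derivative D) (at ((coord d \<circ> param c) (coord c q)))"
    using F cd by (simp add: param_coord)
  show "(((F \<circ> param d) \<circ> (coord d \<circ> param c)) has_derivative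
          (\<lambda>v. D (frechet_derivative (coord d \<circ> param c) (at (coord c q)) v))) (at (coord c q))"
    using diff_chain_at[OF transition_derivative[OF c d] F'] by (simp add: comp_def)
  show "open ?S" using open_overlap cd by blast
  show "coord c q \<in> ?S" using cd by blast
  show "((F \<circ> param d) \<circ> (coord d \<circ> param c)) x = (F \<circ> param c) x" if "x \<in> ?S" for x
    using that cd by (auto simp: param_coord)
qed

lemma frechet_derivative_transition_self:
  assumes "c \<in> charts_at A q"
  shows "frechet_derivative (coord c \<circ> param c) (at (coord c q)) = (\<lambda>v. v)"
proof -
  have c: "c \<in> A" "q \<in> dom_of c" using charts_atD[OF assms] by blast+
  have "((coord c \<circ> param c) has_derivative (\<lambda>v. v)) (at (coord c q))"
    by (rule has_derivative_transform_within_open[OF has_derivative_ident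
          chart_homeomorphism(3)[OF c(1)] coord_in_image[OF assms]])
      (simp add: coord_param[OF c(1)])
  from frechet_derivative_at[OF this] show ?thesis by (rule sym)
qed

text \<open>With \<open>tangent_space_eq_coord_tvec\<close> below, this identifies the tangent space with
  \<open>real ^ 'n\<close> through any chart at the point: the compatibility of the components is the chain rule
  for transition maps.\<close>

lemma coord_tvec_in_tangent_space:
  assumes c: "c \<in> charts_at A q"
  shows "coord_tvec A c q a \<in> tangent_space A q"
proof -
  have "coord_tvec A c q a d =
        frechet_derivative (coord d \<circ> param e) (at (coord e q))
          (coord_tvec A c q a e)"
    if e: "e \<in> charts_at A q" and d: "d \<in> charts_at A q" for d e
    using fun_cong[OF frechet_derivative_at[OF chain_rule_charts[OF c e transition_derivative[OF e d]]],
        of a] e d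
    by (simp only: coord_tvec_def if_True)
  moreover have "coord_tvec A c q a d = 0" if "d \<notin> charts_at A q" for d
    using that by (simp add: coord_tvec_def)
  ultimately show ?thesis
    unfolding tangent_space_def by blast
qed

lemma tangent_space_transition:
  "v \<in> tangent_space A q \<Longrightarrow> c \<in> charts_at A q \<Longrightarrow> d \<in> charts_at A q \<Longrightarrow>
     v d = frechet_derivative (coord d \<circ> param c) (at (coord c q)) (v c)"
  unfolding tangent_space_def by blast

lemma coord_tvec_self: "c \<in> charts_at A q \<Longrightarrow> coord_tvec A c q a c = a"
  by (simp add: coord_tvec_def frechet_derivative_transition_self)

lemma tangent_space_eq_coord_tvec:
  assumes "c \<in> charts_at A q" "v \<in> tangent_space A q"
  shows "v = coord_tvec A c q (v c)"
proof (rule ext)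
  fix d
  show "v d = coord_tvec A c q (v c) d"
  proof (cases "d \<in> charts_at A q")
    case True
    then show ?thesis
      using tangent_space_transition[OF assms(2,1) True] by (simp only: coord_tvec_def if_True)
  next
    case False
    then have "v d = 0" using assms unfolding tangent_space_def by blast
    with False show ?thesis by (simp add: coord_tvec_def)
  qed
qed

lemma linear_transition:
  assumes "c \<in> charts_at A q" "d \<in> charts_at A q"
  shows "linear (frechet_derivative (coord d \<circ> param c) (at (coord c q)))"
  using transition_derivative[OF assms] has_derivative_linear by blast

lemma coord_tvec_add:
  "c \<in> charts_at A q \<Longrightarrow> coord_tvec A c q (a + b) = coord_tvec A c q a + coord_tvec A c q b"
  by (rule ext) (simp add: coord_tvec_def linear_add[OF linear_transition])

lemma coord_tvec_scale:
  "c \<in> charts_at A q \<Longrightarrow> coord_tvec A c q (r *\<^sub>R a) = r *\<^sub>T coord_tvec A c q a"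
  by (rule ext) (simp add: coord_tvec_def tscale_def linear_scale[OF linear_transition])

lemma tangent_space_add:
  assumes "v \<in> tangent_space A q" "w \<in> tangent_space A q"
  shows "v + w \<in> tangent_space A q"
proof -
  obtain c where c: "c \<in> charts_at A q" using charts_at_nonempty by blast
  obtain a b where "v = coord_tvec A c q a" "w = coord_tvec A c q b"
    using tangent_space_eq_coord_tvec[OF c] assms by blast
  then show ?thesis
    using coord_tvec_in_tangent_space[OF c, of "a + b"] by (simp add: coord_tvec_add[OF c])
qed

lemma tangent_space_scale:
  assumes "v \<in> tangent_space A q"
  shows "r *\<^sub>T v \<in> tangent_space A q"
proof -
  obtain c where c: "c \<in> charts_at A q" using charts_at_nonempty by blast
  obtain a where "v = coord_tvec A c q a"
    using tangent_space_eq_coord_tvec[OF c] assms by blast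
  then show ?thesis
    using coord_tvec_in_tangent_space[OF c, of "r *\<^sub>R a"] by (simp add: coord_tvec_scale[OF c])
qed

lemma tangent_space_zero: "0 \<in> tangent_space A q"
proof -
  obtain c where c: "c \<in> charts_at A q" using charts_at_nonempty by blast
  have "(0::('a,'n) tvec) = 0 *\<^sub>T coord_tvec A c q 0"
    by (simp add: tscale_def fun_eq_iff)
  then show ?thesis
    using tangent_space_scale[OF coord_tvec_in_tangent_space[OF c], of 0 0] by simp
qed

lemma tangent_space_sum:
  "(\<And>i. i \<in> I \<Longrightarrow> v i \<in> tangent_space A q) \<Longrightarrow> (\<Sum>i\<in>I. v i) \<in> tangent_space A q"
  by (induction I rule: infinite_finite_induct) (auto simp: tangent_space_zero tangent_space_add)


section \<open>Differentials\<close>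

text \<open>The regularity under which differentials and gradients make sense. It passes from
  the data to the Lagrangian by the sum rule.\<close>

definition differentiable_at_point :: "('a \<Rightarrow> real) \<Rightarrow> 'a \<Rightarrow> bool" where
  "differentiable_at_point F q \<longleftrightarrow>
     (\<forall>c\<in>charts_at A q. (F \<circ> param c) differentiable (at (coord c q)))"

lemma C1_functionD:
  assumes "C1_function A F" "c \<in> A"
  shows "x \<in> image_of c \<Longrightarrow> (F \<circ> param c) differentiable (at x)"
    and "continuous_on (image_of c) (\<lambda>x. frechet_derivative (F \<circ> param c) (at x) b)"
proof -
  have "Ck_on (Suc 0) (F \<circ> param c) (image_of c)"
    using assms by (simp add: C1_function_def)
  then show "x \<in> image_of c \<Longrightarrow> (F \<circ> param c) differentiable (at x)"
    and "continuous_on (image_of c) (\<lambda>x. frechet_derivative (F \<circ> param c) (at x) b)"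
    by simp_all
qed

lemma C1_function_differentiable:
  assumes "C1_function A F"
  shows "differentiable_at_point F q"
  unfolding differentiable_at_point_def
proof
  fix c assume c: "c \<in> charts_at A q"
  then have "c \<in> A" using charts_atD by blast
  from C1_functionD(1)[OF assms this coord_in_image[OF c]]
  show "(F \<circ> param c) differentiable (at (coord c q))" .
qed

lemma differential_in_chart:
  assumes F: "differentiable_at_point F q" and c: "c \<in> charts_at A q"
    and v: "v \<in> tangent_space A q"
  shows "differential A F q v = frechet_derivative (F \<circ> param c) (at (coord c q)) (v c)"
proof -
  define d where "d = (SOME c. c \<in> charts_at A q)"
  have d: "d \<in> charts_at A q"
    unfolding d_def using charts_at_nonempty by (rule someI_ex)
  have "((F \<circ> param d) has_derivative frechet_derivative (F \<circ> param d) (at (coord d q))) (at (coord d q))"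
    using F d by (simp add: differentiable_at_point_def frechet_derivative_works)
  from fun_cong[OF frechet_derivative_at[OF chain_rule_charts[OF c d this]], symmetric]
  have "frechet_derivative (F \<circ> param c) (at (coord c q)) (v c) =
        frechet_derivative (F \<circ> param d) (at (coord d q))
          (frechet_derivative (coord d \<circ> param c) (at (coord c q)) (v c))" .
  also have "frechet_derivative (coord d \<circ> param c) (at (coord c q)) (v c) = v d"
    by (rule tangent_space_transition[OF v c d, symmetric])
  finally show ?thesis
    unfolding differential_def Let_def d_def by (rule sym)
qed

lemma differential_coord_tvec:
  assumes "differentiable_at_point F q" "c \<in> charts_at A q"
  shows "differential A F q (coord_tvec A c q a) =
         frechet_derivative (F \<circ> param c) (at (coord c q)) a"
  using differential_in_chart[OF assms coord_tvec_in_tangent_space] assms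
  by (simp add: coord_tvec_self)

lemma has_derivative_differential:
  assumes "differentiable_at_point F q" "c \<in> charts_at A q"
  shows "((F \<circ> param c) has_derivative (\<lambda>a. differential A F q (coord_tvec A c q a)))
           (at (coord c q))"
  using assms differential_coord_tvec
  by (simp add: differentiable_at_point_def frechet_derivative_works)

lemma has_derivative_lagrangian:
  assumes c: "c \<in> charts_at A q"
    and f: "differentiable_at_point f q"
    and h: "\<And>i. i \<in> {1..s} \<Longrightarrow> differentiable_at_point (h i) q"
    and g: "\<And>j. j \<in> {1..m} \<Longrightarrow> differentiable_at_point (g j) q"
  shows "((lagrangian f s h m g lam mu \<circ> param c) has_derivative
     (\<lambda>a. differential A f q (coord_tvec A c q a)
        + (\<Sum>i=1..s. lam i * differential A (h i) q (coord_tvec A c q a))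
        + (\<Sum>j=1..m. mu j * differential A (g j) q (coord_tvec A c q a)))) (at (coord c q))"
proof -
  have eq: "lagrangian f s h m g lam mu \<circ> param c =
     (\<lambda>x. (f \<circ> param c) x + (\<Sum>i=1..s. lam i * (h i \<circ> param c) x)
          + (\<Sum>j=1..m. mu j * (g j \<circ> param c) x))"
    by (simp add: lagrangian_def fun_eq_iff)
  show ?thesis
    unfolding eq
    by (intro has_derivative_add has_derivative_sum has_derivative_mult_right
        has_derivative_differential f h g c)
qed

lemma lagrangian_differentiable:
  assumes f: "differentiable_at_point f q"
    and h: "\<And>i. i \<in> {1..s} \<Longrightarrow> differentiable_at_point (h i) q"
    and g: "\<And>j. j \<in> {1..m} \<Longrightarrow> differentiable_at_point (g j) q"
  shows "differentiable_at_point (lagrangian f s h m g lam mu) q"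
  unfolding differentiable_at_point_def differentiable_def
  by (intro ballI exI, rule has_derivative_lagrangian) (use f h g in blast)+

lemma differential_lagrangian:
  assumes f: "differentiable_at_point f q"
    and h: "\<And>i. i \<in> {1..s} \<Longrightarrow> differentiable_at_point (h i) q"
    and g: "\<And>j. j \<in> {1..m} \<Longrightarrow> differentiable_at_point (g j) q"
    and w: "w \<in> tangent_space A q"
  shows "differential A (lagrangian f s h m g lam mu) q w = differential A f q w
     + (\<Sum>i=1..s. lam i * differential A (h i) q w) + (\<Sum>j=1..m. mu j * differential A (g j) q w)"
proof -
  obtain c where c: "c \<in> charts_at A q" using charts_at_nonempty by blast
  have "frechet_derivative (lagrangian f s h m g lam mu \<circ> param c) (at (coord c q)) =
     (\<lambda>a. differential A f q (coord_tvec A c q a)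
        + (\<Sum>i=1..s. lam i * differential A (h i) q (coord_tvec A c q a))
        + (\<Sum>j=1..m. mu j * differential A (g j) q (coord_tvec A c q a)))"
    by (rule sym, rule frechet_derivative_at, rule has_derivative_lagrangian) (use c f h g in blast)+
  moreover have "differentiable_at_point (lagrangian f s h m g lam mu) q"
    by (rule lagrangian_differentiable) (use f h g in blast)+
  ultimately show ?thesis
    using differential_in_chart[OF _ c w, of "lagrangian f s h m g lam mu"]
    by (simp only: tangent_space_eq_coord_tvec[OF c w, symmetric])
qed

text \<open>All limits at \<open>p\<close> are computed in one fixed chart \<open>c\<close>, which a sequence converging to \<open>p\<close>
  eventually enters.\<close>

lemma eventually_in_chart:
  assumes "c \<in> charts_at A p" "ps \<longlonglongrightarrow> p"
  shows "eventually (\<lambda>k. c \<in> charts_at A (ps k)) sequentially"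
    and "(\<lambda>k. coord c (ps k)) \<longlonglongrightarrow> coord c p"
proof -
  have c: "c \<in> A" "p \<in> dom_of c" using assms(1) by (auto dest: charts_atD)
  have "eventually (\<lambda>k. ps k \<in> dom_of c) sequentially"
    using assms(2) c chart_homeomorphism(2) topological_tendstoD by blast
  then show "eventually (\<lambda>k. c \<in> charts_at A (ps k)) sequentially"
    by eventually_elim (simp add: charts_at_def c)
  have "continuous_on (dom_of c) (coord c)"
    using chart_homeomorphism(1)[OF c(1)] by (simp add: homeomorphism_def)
  then have "isCont (coord c) p"
    using c chart_homeomorphism(2) continuous_on_eq_continuous_at by blast
  then show "(\<lambda>k. coord c (ps k)) \<longlonglongrightarrow> coord c p"
    using assms(2) isCont_tendsto_compose by blast
qed

lemma tendsto_in_chart: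
  fixes \<phi> :: "real ^ 'n \<Rightarrow> 'b::topological_space"
  assumes c: "c \<in> charts_at A p" and ps: "ps \<longlonglongrightarrow> p" and \<phi>: "continuous_on (image_of c) \<phi>"
  shows "(\<lambda>k. \<phi> (coord c (ps k))) \<longlonglongrightarrow> \<phi> (coord c p)"
proof -
  have "c \<in> A" "coord c p \<in> image_of c"
    using charts_atD[OF c] coord_in_image[OF c] by blast+
  then have "isCont \<phi> (coord c p)"
    using \<phi> chart_homeomorphism(3) continuous_on_eq_continuous_at by blast
  then show ?thesis
    using eventually_in_chart(2)[OF c ps] isCont_tendsto_compose by blast
qed

text \<open>The tangent vectors at the varying points are made comparable by keeping their components in
  \<open>c\<close> constant.\<close>

lemma differential_tendsto:
  assumes F: "C1_function A F" and c: "c \<in> charts_at A p" and ps: "ps \<longlonglongrightarrow> p"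
  shows "(\<lambda>k. differential A F (ps k) (coord_tvec A c (ps k) b))
           \<longlonglongrightarrow> differential A F p (coord_tvec A c p b)"
proof (rule Lim_transform_eventually)
  show "(\<lambda>k. frechet_derivative (F \<circ> param c) (at (coord c (ps k))) b)
           \<longlonglongrightarrow> differential A F p (coord_tvec A c p b)"
    unfolding differential_coord_tvec[OF C1_function_differentiable[OF F] c]
    using tendsto_in_chart[OF c ps C1_functionD(2)[OF F]] charts_atD[OF c] by blast
  show "\<forall>\<^sub>F k in sequentially. frechet_derivative (F \<circ> param c) (at (coord c (ps k))) b =
           differential A F (ps k) (coord_tvec A c (ps k) b)"
    using eventually_in_chart(1)[OF c ps]
    by eventually_elim (simp add: differential_coord_tvec[OF C1_function_differentiable[OF F]])
qed

end


section \<open>Gradients\<close>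

locale riemannian = atlas A
  for A :: "('a::t2_space, 'n::finite) chart set" +
  fixes G :: "('a, 'n) metric_field"
  assumes riemannian_metric: "riemannian_metric A G"
begin

lemma metric_inner_product: "inner_product_on (tangent_space A q) (G q)"
  using riemannian_metric by (simp add: riemannian_metric_def)

lemma metric_sym:
  "u \<in> tangent_space A q \<Longrightarrow> v \<in> tangent_space A q \<Longrightarrow> G q u v = G q v u"
  using metric_inner_product[of q] by (simp add: inner_product_on_def)

lemma metric_add_left:
  "u \<in> tangent_space A q \<Longrightarrow> v \<in> tangent_space A q \<Longrightarrow> w \<in> tangent_space A q \<Longrightarrow>
     G q (u + v) w = G q u w + G q v w"
  using metric_inner_product[of q] by (simp add: inner_product_on_def)

lemma metric_scale_left:
  "u \<in> tangent_space A q \<Longrightarrow> v \<in> tangent_space A q \<Longrightarrow> G q (r *\<^sub>T u) v = r * G q u v"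
  using metric_inner_product[of q] by (simp add: inner_product_on_def)

lemma metric_add_right:
  "u \<in> tangent_space A q \<Longrightarrow> v \<in> tangent_space A q \<Longrightarrow> w \<in> tangent_space A q \<Longrightarrow>
     G q w (u + v) = G q w u + G q w v"
  by (metis metric_add_left metric_sym tangent_space_add)

lemma metric_scale_right:
  "u \<in> tangent_space A q \<Longrightarrow> v \<in> tangent_space A q \<Longrightarrow> G q v (r *\<^sub>T u) = r * G q v u"
  by (metis metric_scale_left metric_sym tangent_space_scale)

lemma metric_pos: "u \<in> tangent_space A q \<Longrightarrow> u \<noteq> 0 \<Longrightarrow> G q u u > 0"
  using metric_inner_product[of q] by (simp add: inner_product_on_def)

lemma metric_zero_left: "u \<in> tangent_space A q \<Longrightarrow> G q 0 u = 0"
  using metric_add_left[of 0 q 0 u] by (simp add: tangent_space_zero)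

lemma metric_nonneg: "u \<in> tangent_space A q \<Longrightarrow> G q u u \<ge> 0"
  by (metis less_eq_real_def metric_pos metric_zero_left)

lemma metric_sum_left:
  "(\<And>i. i \<in> I \<Longrightarrow> v i \<in> tangent_space A q) \<Longrightarrow> w \<in> tangent_space A q \<Longrightarrow>
     G q (\<Sum>i\<in>I. v i) w = (\<Sum>i\<in>I. G q (v i) w)"
  by (induction I rule: infinite_finite_induct)
    (simp_all add: metric_zero_left metric_add_left tangent_space_sum)

lemma Cauchy_Schwarz_metric:
  assumes u: "u \<in> tangent_space A q" and v: "v \<in> tangent_space A q"
  shows "\<bar>G q u v\<bar> \<le> tnorm G q u * tnorm G q v"
proof (cases "v = 0")
  case True
  then show ?thesis
    using u v metric_sym[of u q v] by (simp add: metric_zero_left metric_nonneg tnorm_def)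
next
  case False
  define \<alpha> where "\<alpha> = G q v v"
  define \<beta> where "\<beta> = G q u v"
  (* alpha times the component of u orthogonal to v, which avoids a division *)
  define w where "w = \<alpha> *\<^sub>T u + (- \<beta>) *\<^sub>T v"
  have T: "\<alpha> *\<^sub>T u \<in> tangent_space A q" "(- \<beta>) *\<^sub>T v \<in> tangent_space A q" "w \<in> tangent_space A q"
    using u v by (auto simp: w_def tangent_space_add tangent_space_scale)
  have "G q w v = 0"
    unfolding w_def using T u v
    by (simp add: metric_add_left metric_scale_left \<alpha>_def \<beta>_def)
  then have "G q w w = \<alpha> * G q u w"
    using T u v metric_sym[of v q w] by (subst (1) w_def) (simp add: metric_add_left metric_scale_left)
  also have "G q u w = \<alpha> * G q u u - \<beta> * \<beta>"
    unfolding w_def using T u v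
    by (simp add: metric_add_right metric_scale_right \<beta>_def)
  finally have "0 \<le> \<alpha> * (\<alpha> * G q u u - \<beta> * \<beta>)"
    using metric_nonneg[OF T(3)] by simp
  moreover have "\<alpha> > 0" using metric_pos v False by (simp add: \<alpha>_def)
  ultimately have "\<beta>\<^sup>2 \<le> G q u u * G q v v"
    by (simp add: zero_le_mult_iff power2_eq_square \<alpha>_def mult.commute)
  then have "sqrt (\<beta>\<^sup>2) \<le> sqrt (G q u u * G q v v)"
    by (rule real_sqrt_le_mono)
  then show ?thesis
    by (simp add: tnorm_def \<beta>_def real_sqrt_mult)
qed

lemma metric_in_chart_linear:
  assumes "c \<in> charts_at A q"
  shows "linear (\<lambda>a. G q (coord_tvec A c q a) (coord_tvec A c q b))"
    and "linear (\<lambda>b. G q (coord_tvec A c q a) (coord_tvec A c q b))"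
  using assms
  by (auto intro!: linearI simp: coord_tvec_add coord_tvec_scale coord_tvec_in_tangent_space
      metric_add_left metric_scale_left metric_add_right metric_scale_right)

text \<open>In a chart, \<open>v \<mapsto> G q v\<close> becomes an endomorphism \<open>L\<close> of \<open>real ^ 'n\<close> (the Gram matrix of the
  coordinate vectors). Definiteness makes it injective, hence surjective by finite dimension. This is
  what gives the definite description in \<^const>\<open>gradient\<close> a value.\<close>

lemma Riesz_tangent_space:
  assumes c: "c \<in> charts_at A q" and l: "linear (\<lambda>a. l (coord_tvec A c q a))"
  shows "\<exists>!v. v \<in> tangent_space A q \<and> (\<forall>w\<in>tangent_space A q. G q v w = l w)"
proof -
  let ?e = "coord_tvec A c q"
  note T = coord_tvec_in_tangent_space[OF c]
  define L where "L a = (\<Sum>b\<in>Basis. G q (?e a) (?e b) *\<^sub>R b)" for a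
  have Lb: "L a \<bullet> b = G q (?e a) (?e b)" if "b \<in> Basis" for a b
    unfolding L_def using that by simp
  have linL: "linear L"
    unfolding L_def
    by (intro linear_compose_sum ballI)
      (auto intro!: linearI simp: linear_add[OF metric_in_chart_linear(1)[OF c]]
        linear_scale[OF metric_in_chart_linear(1)[OF c]] scaleR_add_left)
  have zero: "a = 0" if "\<And>b. G q (?e a) (?e b) = 0" for a
  proof -
    have "?e a = 0" using that[of a] metric_pos[OF T[of a]] by force
    then have "?e a c = 0" by simp
    then show ?thesis by (simp add: coord_tvec_self[OF c])
  qed
  have ext: "(\<lambda>b. G q (?e a) (?e b)) = l'"
    if "linear l'" "\<And>b. b \<in> Basis \<Longrightarrow> G q (?e a) (?e b) = l' b" for a l'
    using linear_eq_stdbasis[OF metric_in_chart_linear(2)[OF c, of a] that(1)] that(2) by blast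
  have "inj L"
    unfolding linear_injective_0[OF linL]
  proof (intro allI impI)
    fix a assume "L a = 0"
    then have "(\<lambda>b. G q (?e a) (?e b)) = (\<lambda>b. 0)"
      using Lb[of _ a] by (intro ext) (auto intro: linearI)
    then show "a = 0" using zero by meson
  qed
  then have "surj L" using linL linear_injective_imp_surjective by blast
  then obtain a where a: "L a = (\<Sum>b\<in>Basis. l (?e b) *\<^sub>R b)" by (metis surj_def)
  have "(\<lambda>b. G q (?e a) (?e b)) = (\<lambda>b. l (?e b))"
    using l by (rule ext) (simp add: Lb[symmetric] a)
  then have aG: "G q (?e a) w = l w" if "w \<in> tangent_space A q" for w
    by (subst (1 2) tangent_space_eq_coord_tvec[OF c that]) (rule fun_cong)
  show ?thesis
  proof (rule ex1I[of _ "?e a"])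
    show "?e a \<in> tangent_space A q \<and> (\<forall>w\<in>tangent_space A q. G q (?e a) w = l w)"
      using T aG by blast
    fix v assume v: "v \<in> tangent_space A q \<and> (\<forall>w\<in>tangent_space A q. G q v w = l w)"
    have ve: "v = ?e (v c)" using tangent_space_eq_coord_tvec[OF c] v by blast
    have "G q (?e (v c - a)) (?e b) = 0" for b
    proof -
      have "G q (?e (v c)) (?e b) = l (?e b)"
        using v T[of b] by (simp only: ve[symmetric])
      then show ?thesis
        using aG[OF T[of b]] linear_diff[OF metric_in_chart_linear(1)[OF c, of b]] by simp
    qed
    then have "v c = a" using zero by force
    then show "v = ?e a" using ve by simp
  qed
qed

lemma gradient_characterization:
  assumes F: "differentiable_at_point F q"
  shows "gradient A G F q \<in> tangent_space A q"
    and "\<And>w. w \<in> tangent_space A q \<Longrightarrow> G q (gradient A G F q) w = differential A F q w"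
proof -
  obtain c where c: "c \<in> charts_at A q" using charts_at_nonempty by blast
  have "linear (\<lambda>a. differential A F q (coord_tvec A c q a))"
    using has_derivative_differential[OF F c] has_derivative_linear by blast
  from theI'[OF Riesz_tangent_space[OF c this]]
  show "gradient A G F q \<in> tangent_space A q"
    and "\<And>w. w \<in> tangent_space A q \<Longrightarrow> G q (gradient A G F q) w = differential A F q w"
    by (auto simp: gradient_def)
qed

lemma gradient_eq_0:
  assumes F: "differentiable_at_point F q"
    and "\<And>w. w \<in> tangent_space A q \<Longrightarrow> differential A F q w = 0"
  shows "gradient A G F q = 0"
  using gradient_characterization[OF F] assms(2) metric_pos less_irrefl by metis

text \<open>A tangent vector orthogonal to every tangent vector is zero, so relations between differentials
  lift to relations between gradients.\<close>

lemma gradient_combination_eq_0: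
  assumes h: "\<And>i. i \<in> I \<Longrightarrow> differentiable_at_point (h i) q"
    and g: "\<And>j. j \<in> J \<Longrightarrow> differentiable_at_point (g j) q"
    and 0: "\<And>w. w \<in> tangent_space A q \<Longrightarrow>
      (\<Sum>i\<in>I. lam i * differential A (h i) q w) + (\<Sum>j\<in>J. mu j * differential A (g j) q w) = 0"
  shows "(\<Sum>i\<in>I. lam i *\<^sub>T gradient A G (h i) q) + (\<Sum>j\<in>J. mu j *\<^sub>T gradient A G (g j) q) = 0"
    (is "?u + ?v = 0")
proof -
  have Th: "lam i *\<^sub>T gradient A G (h i) q \<in> tangent_space A q" if "i \<in> I" for i
    using gradient_characterization(1)[OF h] tangent_space_scale that by blast
  have Tg: "mu j *\<^sub>T gradient A G (g j) q \<in> tangent_space A q" if "j \<in> J" for j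
    using gradient_characterization(1)[OF g] tangent_space_scale that by blast
  have T: "?u \<in> tangent_space A q" "?v \<in> tangent_space A q"
    using Th Tg by (auto intro: tangent_space_sum)
  have "G q (?u + ?v) w = 0" if w: "w \<in> tangent_space A q" for w
  proof -
    have "G q (?u + ?v) w = (\<Sum>i\<in>I. G q (lam i *\<^sub>T gradient A G (h i) q) w) +
        (\<Sum>j\<in>J. G q (mu j *\<^sub>T gradient A G (g j) q) w)"
      using w T Th Tg by (simp add: metric_add_left metric_sum_left)
    also have "\<dots> = (\<Sum>i\<in>I. lam i * differential A (h i) q w) +
        (\<Sum>j\<in>J. mu j * differential A (g j) q w)"
      using w h g
      by (intro arg_cong2[where f = plus] sum.cong)
        (auto simp: metric_scale_left gradient_characterization)
    finally show ?thesis using 0[OF w] by simp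
  qed
  then show ?thesis
    using metric_pos[OF tangent_space_add[OF T]] tangent_space_add[OF T] by force
qed

lemma metric_in_chart_continuous:
  assumes "c \<in> A"
  shows "continuous_on (image_of c)
    (\<lambda>x. G (param c x) (coord_tvec A c (param c x) a) (coord_tvec A c (param c x) b))"
proof -
  have "smooth_on
    (\<lambda>x. G (param c x) (coord_tvec A c (param c x) a) (coord_tvec A c (param c x) b)) (image_of c)"
    using riemannian_metric assms by (simp add: riemannian_metric_def)
  then have "Ck_on 0
    (\<lambda>x. G (param c x) (coord_tvec A c (param c x) a) (coord_tvec A c (param c x) b)) (image_of c)"
    by (simp only: smooth_on_def)
  then show ?thesis by simp
qed

lemma tnorm_coord_tvec_tendsto:
  assumes c: "c \<in> charts_at A p" and ps: "ps \<longlonglongrightarrow> p"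
  shows "(\<lambda>k. tnorm G (ps k) (coord_tvec A c (ps k) b)) \<longlonglongrightarrow> tnorm G p (coord_tvec A c p b)"
  unfolding tnorm_def
proof (intro tendsto_real_sqrt)
  have cA: "c \<in> A" "p \<in> dom_of c" using c by (auto dest: charts_atD)
  let ?\<phi> = "\<lambda>x. G (param c x) (coord_tvec A c (param c x) b) (coord_tvec A c (param c x) b)"
  have "(\<lambda>k. ?\<phi> (coord c (ps k))) \<longlonglongrightarrow> ?\<phi> (coord c p)"
    using tendsto_in_chart[OF c ps metric_in_chart_continuous[OF cA(1)]] .
  then have "(\<lambda>k. ?\<phi> (coord c (ps k))) \<longlonglongrightarrow> G p (coord_tvec A c p b) (coord_tvec A c p b)"
    using cA by (simp add: param_coord)
  moreover have "\<forall>\<^sub>F k in sequentially. ?\<phi> (coord c (ps k)) =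
      G (ps k) (coord_tvec A c (ps k) b) (coord_tvec A c (ps k) b)"
    using eventually_in_chart(1)[OF c ps]
    by eventually_elim (auto simp: param_coord dest: charts_atD)
  ultimately show "(\<lambda>k. G (ps k) (coord_tvec A c (ps k) b) (coord_tvec A c (ps k) b))
      \<longlonglongrightarrow> G p (coord_tvec A c p b) (coord_tvec A c p b)"
    by (rule Lim_transform_eventually)
qed


section \<open>Riemannian balls are neighbourhoods\<close>

text \<open>Near a point, the metric is dominated by the Euclidean norm of the chart: on a compact
  coordinate ball its finitely many coefficients are bounded.\<close>

lemma tnorm_bound_near:
  assumes c: "c \<in> charts_at A p"
  obtains r K where "r > 0" "K > 0" "cball (coord c p) r \<subseteq> image_of c"
    "\<And>x v. x \<in> cball (coord c p) r \<Longrightarrow>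
       tnorm G (param c x) (coord_tvec A c (param c x) v) \<le> K * norm v"
proof -
  have cA: "c \<in> A" using charts_atD[OF c] by blast
  define e where "e x v = coord_tvec A c (param c x) v" for x v
  define \<Gamma> where "\<Gamma> i j x = G (param c x) (e x i) (e x j)" for i j x
  obtain r where r: "r > 0" "cball (coord c p) r \<subseteq> image_of c"
    using chart_homeomorphism(3)[OF cA] coord_in_image[OF c] open_contains_cball by blast
  have "\<exists>M. \<forall>x\<in>cball (coord c p) r. \<bar>\<Gamma> i j x\<bar> \<le> M" for i j
  proof -
    have "continuous_on (cball (coord c p) r) (\<Gamma> i j)"
      unfolding \<Gamma>_def e_def using metric_in_chart_continuous[OF cA] r(2) by (rule continuous_on_subset)
    then have "bounded (\<Gamma> i j ` cball (coord c p) r)"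
      by (intro compact_imp_bounded compact_continuous_image compact_cball)
    then show ?thesis by (simp add: bounded_iff)
  qed
  then obtain M where M: "\<And>i j x. x \<in> cball (coord c p) r \<Longrightarrow> \<bar>\<Gamma> i j x\<bar> \<le> M i j"
    by metis
  define S where "S = (\<Sum>i\<in>Basis. \<Sum>j\<in>Basis. M i j)"
  have "tnorm G (param c x) (e x v) \<le> (sqrt \<bar>S\<bar> + 1) * norm v"
    if x: "x \<in> cball (coord c p) r" for x v
  proof -
    have cx: "c \<in> charts_at A (param c x)"
      using param_in_dom[OF cA subsetD[OF r(2) x]] by (simp add: charts_at_def cA)
    note lin = metric_in_chart_linear[OF cx]
    have expand: "L v = (\<Sum>i\<in>Basis. (v \<bullet> i) * L i)" if "linear L" for L :: "real ^ 'n \<Rightarrow> real"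
    proof -
      have "L v = L (\<Sum>i\<in>Basis. (v \<bullet> i) *\<^sub>R i)" by (simp add: euclidean_representation)
      also have "\<dots> = (\<Sum>i\<in>Basis. (v \<bullet> i) * L i)"
        using that by (simp add: linear_sum linear_scale del: euclidean_representation)
      finally show ?thesis .
    qed
    have "\<Gamma> v v x = (\<Sum>i\<in>Basis. (v \<bullet> i) * (\<Sum>j\<in>Basis. (v \<bullet> j) * \<Gamma> i j x))"
      unfolding \<Gamma>_def e_def
      by (subst expand[OF lin(1)], subst expand[OF lin(2)]) (rule refl)
    also have "\<dots> = (\<Sum>i\<in>Basis. \<Sum>j\<in>Basis. (v \<bullet> i) * (v \<bullet> j) * \<Gamma> i j x)"
      by (simp add: sum_distrib_left mult.assoc)
    also have "\<dots> \<le> (\<Sum>i\<in>Basis. \<Sum>j\<in>Basis. norm v * norm v * M i j)"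
    proof (intro sum_mono)
      fix i j :: "real ^ 'n" assume ij: "i \<in> Basis" "j \<in> Basis"
      have "(v \<bullet> i) * (v \<bullet> j) * \<Gamma> i j x \<le> \<bar>v \<bullet> i\<bar> * \<bar>v \<bullet> j\<bar> * \<bar>\<Gamma> i j x\<bar>"
        by (metis abs_ge_self abs_mult)
      also have "\<dots> \<le> norm v * norm v * M i j"
        using ij M[OF x] by (intro mult_mono) (auto simp: Basis_le_norm)
      finally show "(v \<bullet> i) * (v \<bullet> j) * \<Gamma> i j x \<le> norm v * norm v * M i j" .
    qed
    also have "\<dots> = (norm v)\<^sup>2 * S"
      by (simp add: S_def sum_distrib_left power2_eq_square)
    also have "\<dots> \<le> (norm v)\<^sup>2 * \<bar>S\<bar>"
      by (intro mult_left_mono) auto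
    finally have "sqrt (\<Gamma> v v x) \<le> sqrt ((norm v)\<^sup>2 * \<bar>S\<bar>)"
      by (rule real_sqrt_le_mono)
    also have "\<dots> \<le> (sqrt \<bar>S\<bar> + 1) * norm v"
      by (simp add: real_sqrt_mult algebra_simps)
    finally show ?thesis by (simp add: tnorm_def \<Gamma>_def)
  qed
  moreover have "sqrt \<bar>S\<bar> + 1 > 0"
    using real_sqrt_ge_zero[of "\<bar>S\<bar>"] by linarith
  ultimately show ?thesis
    using that[OF r(1) _ r(2)] unfolding e_def by blast
qed

text \<open>The witness curve is the segment between the two points in the chart.\<close>

lemma riem_dist_le_coordinate_distance:
  assumes c: "c \<in> charts_at A p" "c \<in> charts_at A q"
    and image: "cball (coord c p) r \<subseteq> image_of c"
    and bound: "\<And>x v. x \<in> cball (coord c p) r \<Longrightarrow>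
       tnorm G (param c x) (coord_tvec A c (param c x) v) \<le> K * norm v"
    and q: "norm (coord c q - coord c p) \<le> r"
  shows "riem_dist A G p q \<le> ennreal (K * norm (coord c q - coord c p))"
proof -
  have cA: "c \<in> A" "p \<in> dom_of c" "q \<in> dom_of c" using c charts_atD by blast+
  define v where "v = coord c q - coord c p"
  define l where "l t = coord c p + t *\<^sub>R v" for t :: real
  define \<gamma> where "\<gamma> = param c \<circ> l"
  have l_cball: "l t \<in> cball (coord c p) r" if "t \<in> {0..1}" for t
  proof -
    have "dist (coord c p) (l t) = \<bar>t\<bar> * norm v" by (simp add: l_def dist_norm)
    also have "\<dots> \<le> 1 * norm v" using that by (intro mult_right_mono) auto
    finally show ?thesis using q by (simp add: v_def)
  qed
  then have l_image: "l t \<in> image_of c" if "t \<in> {0..1}" for t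
    using that image by blast
  have l_cont: "continuous_on X l" for X
    unfolding l_def by (intro continuous_intros)
  have l_deriv: "(l has_vector_derivative v) (at t)" for t
    unfolding l_def by (auto intro!: derivative_eq_intros)
  have \<gamma>c: "c \<in> charts_at A (\<gamma> t)" "coord c (\<gamma> t) = l t" if "t \<in> {0..1}" for t
    using l_image[OF that] cA param_in_dom coord_param by (auto simp: \<gamma>_def charts_at_def)
  have deriv: "((coord d \<circ> \<gamma>) has_vector_derivative
      frechet_derivative (coord d \<circ> param c) (at (l t)) v) (at t)"
    if t: "t \<in> {0..1}" and d: "d \<in> charts_at A (\<gamma> t)" for t d
  proof -
    have "((coord d \<circ> param c) has_derivative frechet_derivative (coord d \<circ> param c) (at (l t)))
        (at (l t) within range l)"
      using transition_derivative[OF \<gamma>c(1)[OF t] d] \<gamma>c(2)[OF t]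
      by (simp add: has_derivative_at_withinI)
    from vector_derivative_diff_chain_within[OF l_deriv this]
    show ?thesis by (simp only: \<gamma>_def o_assoc)
  qed
  have "path \<gamma>"
    unfolding path_def \<gamma>_def
  proof (intro continuous_on_compose l_cont)
    have "continuous_on (image_of c) (param c)"
      using chart_homeomorphism(1)[OF cA(1)] by (simp add: homeomorphism_def)
    then show "continuous_on (l ` {0..1}) (param c)"
      using l_image by (elim continuous_on_subset) blast
  qed
  moreover have "(coord d \<circ> \<gamma>) C1_differentiable_on {t \<in> {0..1} - {}. \<gamma> t \<in> dom_of d}"
    if d: "d \<in> A" for d
    unfolding C1_differentiable_on_def
  proof (intro exI conjI ballI)
    fix t assume t: "t \<in> {t \<in> {0..1} - {}. \<gamma> t \<in> dom_of d}"
    then have "d \<in> charts_at A (\<gamma> t)" using d by (simp add: charts_at_def)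
    with t show "((coord d \<circ> \<gamma>) has_vector_derivative
        frechet_derivative (coord d \<circ> param c) (at (l t)) v) (at t)"
      using deriv by blast
  next
    have ov: "l t \<in> coord c ` (dom_of c \<inter> dom_of d)" if "t \<in> {t \<in> {0..1} - {}. \<gamma> t \<in> dom_of d}" for t
      using that l_image[of t] by (intro overlapI cA) (auto simp: \<gamma>_def)
    show "continuous_on {t \<in> {0..1} - {}. \<gamma> t \<in> dom_of d}
        (\<lambda>t. frechet_derivative (coord d \<circ> param c) (at (l t)) v)"
    proof (cases "{t \<in> {0..1} - {}. \<gamma> t \<in> dom_of d} = {}")
      case True
      then show ?thesis by (simp only: continuous_on_empty)
    next
      case False
      then obtain x where "x \<in> coord c ` (dom_of c \<inter> dom_of d)" using ov by blast
      from continuous_on_compose2[OF transition_C1(2)[OF cA(1) d this] l_cont]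
      show ?thesis using ov by blast
    qed
  qed
  ultimately have curve: "piecewise_C1_curve A \<gamma>"
    unfolding piecewise_C1_curve_def by (intro conjI exI[of _ "{}"]) auto
  have velocity: "velocity A \<gamma> t = coord_tvec A c (\<gamma> t) v" if "t \<in> {0..1}" for t
    using vector_derivative_at[OF deriv[OF that]] \<gamma>c(2)[OF that]
    by (intro ext) (simp add: velocity_def coord_tvec_def)
  have "curve_length A G \<gamma> \<le> (\<integral>\<^sup>+ t. ennreal (K * norm v) * indicator {0..1::real} t \<partial>lborel)"
    unfolding curve_length_def
  proof (intro nn_integral_mono)
    fix t :: real
    have "tnorm G (\<gamma> t) (velocity A \<gamma> t) \<le> K * norm v" if "t \<in> {0..1}"
      using bound[OF l_cball[OF that]] velocity[OF that] by (simp add: \<gamma>_def)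
    then show "ennreal (tnorm G (\<gamma> t) (velocity A \<gamma> t)) * indicator {0..1} t
        \<le> ennreal (K * norm v) * indicator {0..1} t"
      by (auto simp: indicator_def intro: ennreal_leI)
  qed
  also have "\<dots> = ennreal (K * norm v)"
    by (simp add: nn_integral_cmult_indicator)
  finally have len: "curve_length A G \<gamma> \<le> ennreal (K * norm v)" .
  have "pathstart \<gamma> = p" "pathfinish \<gamma> = q"
    using cA by (simp_all add: \<gamma>_def l_def v_def pathstart_def pathfinish_def param_coord)
  with curve have "riem_dist A G p q \<le> curve_length A G \<gamma>"
    unfolding riem_dist_def by (intro INF_lower) simp
  then show ?thesis using len unfolding v_def by (rule order_trans)
qed

lemma eventually_in_riem_ball:
  assumes ps: "ps \<longlonglongrightarrow> p" and "\<epsilon> > 0"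
  shows "\<forall>\<^sub>F k in sequentially. ps k \<in> riem_ball A G p \<epsilon>"
proof -
  obtain c where c: "c \<in> charts_at A p" using charts_at_nonempty by blast
  obtain r K where rK: "r > 0" "K > 0" "cball (coord c p) r \<subseteq> image_of c"
    "\<And>x v. x \<in> cball (coord c p) r \<Longrightarrow>
       tnorm G (param c x) (coord_tvec A c (param c x) v) \<le> K * norm v"
    using tnorm_bound_near[OF c] by blast
  have "min r (\<epsilon> / K) > 0" using rK \<open>\<epsilon> > 0\<close> by simp
  with eventually_in_chart(2)[OF c ps]
  have "\<forall>\<^sub>F k in sequentially. dist (coord c (ps k)) (coord c p) < min r (\<epsilon> / K)"
    by (rule tendstoD)
  with eventually_in_chart(1)[OF c ps] show ?thesis
  proof eventually_elim
    case (elim k)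
    then have "norm (coord c (ps k) - coord c p) \<le> r"
      and "norm (coord c (ps k) - coord c p) < \<epsilon> / K"
      by (simp_all add: dist_norm)
    then have "riem_dist A G p (ps k) \<le> ennreal (K * norm (coord c (ps k) - coord c p))"
      and "K * norm (coord c (ps k) - coord c p) < \<epsilon>"
      using riem_dist_le_coordinate_distance[OF c elim(1) rK(3,4)] rK(2)
      by (simp_all add: pos_less_divide_eq mult.commute)
    then show ?case
      unfolding riem_ball_def using \<open>\<epsilon> > 0\<close>
      by (simp add: ennreal_lessI order_le_less_trans)
  qed
qed


section \<open>Limits of approximate stationarity\<close>

text \<open>The scaling \<open>a\<close> serves both passages to the limit: \<open>a = 1\<close> for a convergent dual sequence, and
  \<open>a = 1 / \<gamma>\<close> with limit \<open>0\<close>, which removes \<open>f\<close>, for one whose norms \<open>\<gamma>\<close> tend to infinity.\<close>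

lemma scaled_stationarity_limit:
  assumes f: "C1_function A f"
    and h: "\<And>i. i \<in> {1..s} \<Longrightarrow> C1_function A (h i)"
    and g: "\<And>j. j \<in> {1..m} \<Longrightarrow> C1_function A (g j)"
    and ps: "ps \<longlonglongrightarrow> p"
    and grad: "(\<lambda>k. tnorm G (ps k)
           (gradient A G (lagrangian f s h m g (lams k) (mus k)) (ps k))) \<longlonglongrightarrow> 0"
    and a: "a \<longlonglongrightarrow> a0"
    and \<alpha>: "\<And>i. i \<in> {1..s} \<Longrightarrow> (\<lambda>k. a k * lams k i) \<longlonglongrightarrow> \<alpha> i"
    and \<beta>: "\<And>j. j \<in> {1..m} \<Longrightarrow> (\<lambda>k. a k * mus k j) \<longlonglongrightarrow> \<beta> j"
    and w: "w \<in> tangent_space A p"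
  shows "a0 * differential A f p w + (\<Sum>i=1..s. \<alpha> i * differential A (h i) p w)
           + (\<Sum>j=1..m. \<beta> j * differential A (g j) p w) = 0"
proof -
  obtain c where c: "c \<in> charts_at A p" using charts_at_nonempty by blast
  define W where "W q = coord_tvec A c q (w c)" for q
  have Wp: "W p = w" using tangent_space_eq_coord_tvec[OF c w] by (simp add: W_def)
  define dL where "dL k = differential A (lagrangian f s h m g (lams k) (mus k)) (ps k) (W (ps k))" for k
  note df = C1_function_differentiable[OF f]
    and dh = C1_function_differentiable[OF h]
    and dg = C1_function_differentiable[OF g]
  have tends: "(\<lambda>k. differential A F (ps k) (W (ps k))) \<longlonglongrightarrow> differential A F p w"
    if "C1_function A F" for F
    using differential_tendsto[OF that c ps, of "w c"] Wp by (simp add: W_def)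
  have "dL \<longlonglongrightarrow> 0"
  proof (rule Lim_null_comparison)
    show "\<forall>\<^sub>F k in sequentially. norm (dL k) \<le> tnorm G (ps k)
        (gradient A G (lagrangian f s h m g (lams k) (mus k)) (ps k)) * tnorm G (ps k) (W (ps k))"
      using eventually_in_chart(1)[OF c ps]
    proof eventually_elim
      case (elim k)
      have T: "W (ps k) \<in> tangent_space A (ps k)"
        unfolding W_def by (rule coord_tvec_in_tangent_space[OF elim])
      have "differentiable_at_point (lagrangian f s h m g (lams k) (mus k)) (ps k)"
        by (rule lagrangian_differentiable) (use df dh dg in blast)+
      note grad = gradient_characterization[OF this]
      show ?case
        using Cauchy_Schwarz_metric[OF grad(1) T] grad(2)[OF T] by (simp add: dL_def)
    qed
    show "(\<lambda>k. tnorm G (ps k) (gradient A G (lagrangian f s h m g (lams k) (mus k)) (ps k))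
        * tnorm G (ps k) (W (ps k))) \<longlonglongrightarrow> 0"
      using tendsto_mult[OF grad tnorm_coord_tvec_tendsto[OF c ps, of "w c"]] by (simp add: W_def)
  qed
  then have "(\<lambda>k. a k * dL k) \<longlonglongrightarrow> 0"
    using tendsto_mult[OF a] by fastforce
  moreover have "\<forall>\<^sub>F k in sequentially. a k * dL k = a k * differential A f (ps k) (W (ps k))
      + (\<Sum>i=1..s. (a k * lams k i) * differential A (h i) (ps k) (W (ps k)))
      + (\<Sum>j=1..m. (a k * mus k j) * differential A (g j) (ps k) (W (ps k)))"
    using eventually_in_chart(1)[OF c ps]
  proof eventually_elim
    case (elim k)
    have "W (ps k) \<in> tangent_space A (ps k)"
      unfolding W_def by (rule coord_tvec_in_tangent_space[OF elim])
    then have "dL k = differential A f (ps k) (W (ps k))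
      + (\<Sum>i=1..s. lams k i * differential A (h i) (ps k) (W (ps k)))
      + (\<Sum>j=1..m. mus k j * differential A (g j) (ps k) (W (ps k)))"
      unfolding dL_def by (intro differential_lagrangian) (use df dh dg in blast)+
    then show ?case by (simp add: distrib_left sum_distrib_left mult.assoc)
  qed
  ultimately have "(\<lambda>k. a k * differential A f (ps k) (W (ps k))
      + (\<Sum>i=1..s. (a k * lams k i) * differential A (h i) (ps k) (W (ps k)))
      + (\<Sum>j=1..m. (a k * mus k j) * differential A (g j) (ps k) (W (ps k)))) \<longlonglongrightarrow> 0"
    by (rule Lim_transform_eventually)
  moreover have "(\<lambda>k. a k * differential A f (ps k) (W (ps k))
      + (\<Sum>i=1..s. (a k * lams k i) * differential A (h i) (ps k) (W (ps k)))
      + (\<Sum>j=1..m. (a k * mus k j) * differential A (g j) (ps k) (W (ps k)))) \<longlonglongrightarrow>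
      a0 * differential A f p w + (\<Sum>i=1..s. \<alpha> i * differential A (h i) p w)
           + (\<Sum>j=1..m. \<beta> j * differential A (g j) p w)"
    by (intro tendsto_add tendsto_sum tendsto_mult a \<alpha> \<beta> tends f h g)
  ultimately show ?thesis using LIMSEQ_unique by blast
qed

lemma dual_limit_point_is_multiplier:
  assumes f: "C1_function A f"
    and h: "\<And>i. i \<in> {1..s} \<Longrightarrow> C1_function A (h i)"
    and g: "\<And>j. j \<in> {1..m} \<Longrightarrow> C1_function A (g j)"
    and P: "PAKKT_point_with A G f s h m g p ps lams mus"
    and lim: "dual_limit_point s m lams mus lam mu"
  shows "lagrange_multiplier A G f s h m g p lam mu"
proof -
  obtain r where r: "strict_mono r"
    and lam: "\<And>i. i \<in> {1..s} \<Longrightarrow> (\<lambda>k. lams (r k) i) \<longlonglongrightarrow> lam i"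
    and mu: "\<And>j. j \<in> {1..m} \<Longrightarrow> (\<lambda>k. mus (r k) j) \<longlonglongrightarrow> mu j"
    using lim unfolding dual_limit_point_def by blast
  have fr: "filterlim r sequentially sequentially"
    using r by (rule filterlim_subseq)
  have ps: "(\<lambda>k. ps (r k)) \<longlonglongrightarrow> p"
    and grad: "(\<lambda>k. tnorm G (ps (r k))
      (gradient A G (lagrangian f s h m g (lams (r k)) (mus (r k))) (ps (r k)))) \<longlonglongrightarrow> 0"
    using P unfolding PAKKT_point_with_def by (auto intro: filterlim_compose[OF _ fr])
  have nonneg: "mus k j \<ge> 0" if "j \<in> {1..m}" for k j
    using P that unfolding PAKKT_point_with_def by blast
  have "\<forall>\<^sub>F k in sequentially. \<forall>j\<in>{1..m} - active_set m g p. mus k j = 0"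
    using P unfolding PAKKT_point_with_def by blast
  then have inactive: "\<forall>\<^sub>F k in sequentially. \<forall>j\<in>{1..m} - active_set m g p. mus (r k) j = 0"
    using fr by (rule eventually_compose_filterlim)
  have "mu j \<ge> 0" if "j \<in> {1..m}" for j
    using mu[OF that] by (rule LIMSEQ_le_const) (use nonneg that in blast)
  moreover have "mu j = 0" if j: "j \<in> {1..m} - active_set m g p" for j
  proof (rule LIMSEQ_unique)
    show "(\<lambda>k. mus (r k) j) \<longlonglongrightarrow> mu j" using mu j by blast
    show "(\<lambda>k. mus (r k) j) \<longlonglongrightarrow> 0"
      by (rule tendsto_eventually, rule eventually_mono[OF inactive]) (use j in blast)
  qed
  moreover have "gradient A G (lagrangian f s h m g lam mu) p = 0"
  proof (rule gradient_eq_0)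
    note df = C1_function_differentiable[OF f]
      and dh = C1_function_differentiable[OF h]
      and dg = C1_function_differentiable[OF g]
    show "differentiable_at_point (lagrangian f s h m g lam mu) p"
      by (rule lagrangian_differentiable) (use df dh dg in blast)+
    fix w assume w: "w \<in> tangent_space A p"
    have "differential A (lagrangian f s h m g lam mu) p w = differential A f p w
      + (\<Sum>i=1..s. lam i * differential A (h i) p w) + (\<Sum>j=1..m. mu j * differential A (g j) p w)"
      by (rule differential_lagrangian) (use df dh dg w in blast)+
    also have "\<dots> = 1 * differential A f p w
      + (\<Sum>i=1..s. lam i * differential A (h i) p w) + (\<Sum>j=1..m. mu j * differential A (g j) p w)"
      by simp
    also have "\<dots> = 0"
      by (rule scaled_stationarity_limit[OF f _ _ ps grad tendsto_const _ _ w])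
        (use h g lam mu in simp_all)
    finally show "differential A (lagrangian f s h m g lam mu) p w = 0" .
  qed
  ultimately show ?thesis
    unfolding lagrange_multiplier_def by blast
qed

end


section \<open>Subsequences of dual sequences\<close>

text \<open>Bolzano-Weierstrass in \<open>\<real>\<^sup>I\<close>, one coordinate at a time. Index sets are used instead of a vector
  type because the numbers of constraints are natural numbers and not types.\<close>

lemma convergent_subsequence_finite_family:
  fixes z :: "nat \<Rightarrow> 'i \<Rightarrow> real"
  assumes "finite I" and "\<And>k i. i \<in> I \<Longrightarrow> \<bar>z k i\<bar> \<le> B"
  shows "\<exists>r l. strict_mono (r :: nat \<Rightarrow> nat) \<and> (\<forall>i\<in>I. (\<lambda>k. z (r k) i) \<longlonglongrightarrow> l i)"
  using assms
proof (induction I)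
  case empty
  show ?case by (rule exI[of _ id]) (simp add: strict_mono_def)
next
  case (insert i I)
  obtain r l where r: "strict_mono r" and l: "\<And>i. i \<in> I \<Longrightarrow> (\<lambda>k. z (r k) i) \<longlonglongrightarrow> l i"
    using insert.IH[OF insert.prems[OF insertI2]] by blast
  have "bounded (range (\<lambda>k. z (r k) i))"
    using insert.prems by (auto simp: bounded_iff)
  then obtain x r' where r': "strict_mono r'" and x: "((\<lambda>k. z (r k) i) \<circ> r') \<longlonglongrightarrow> x"
    using bounded_imp_convergent_subsequence by blast
  have "(\<lambda>k. z ((r \<circ> r') k) j) \<longlonglongrightarrow> (l(i := x)) j" if "j \<in> insert i I" for j
  proof (cases "j = i")
    case True
    then show ?thesis using x by (simp add: o_def)
  next
    case False
    then show ?thesis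
      using that LIMSEQ_subseq_LIMSEQ[OF l r'] by (simp add: o_def)
  qed
  then show ?case
    using strict_mono_o[OF r r'] by blast
qed

lemma subsequence_at_top:
  fixes x :: "nat \<Rightarrow> real"
  assumes "\<And>B. \<exists>k. x k > B"
  obtains r :: "nat \<Rightarrow> nat" where "strict_mono r" "filterlim (\<lambda>k. x (r k)) at_top sequentially"
proof -
  have step: "\<exists>k>N. x k > B" for N B
  proof -
    obtain k where k: "x k > Max (insert B (x ` {..N}))" using assms by blast
    then have "x k > B" "\<And>i. i \<le> N \<Longrightarrow> x k > x i" by auto
    then show ?thesis by (metis less_irrefl not_le)
  qed
  have "\<exists>r. \<forall>n. x (r n) > real n \<and> r n < r (Suc n)"
  proof (rule dependent_nat_choice)
    show "\<exists>k. x k > real 0" by (rule assms)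
    show "\<exists>l. x l > real (Suc n) \<and> k < l" for k n
      using step[of k "real (Suc n)"] by blast
  qed
  then obtain r where r: "\<And>n. x (r n) > real n" "\<And>n. r n < r (Suc n)" by blast
  show ?thesis
  proof
    show "strict_mono r" using r(2) by (simp add: strict_mono_Suc_iff)
    show "filterlim (\<lambda>k. x (r k)) at_top sequentially"
      by (rule filterlim_at_top_mono[OF filterlim_real_sequentially]) (simp add: r(1) less_imp_le)
  qed
qed

lemma max_norm1_ge:
  "1 \<le> max_norm1 s m lam mu"
  "i \<in> {1..s} \<Longrightarrow> \<bar>lam i\<bar> \<le> max_norm1 s m lam mu"
  "j \<in> {1..m} \<Longrightarrow> \<bar>mu j\<bar> \<le> max_norm1 s m lam mu"
  unfolding max_norm1_def by (rule Max_ge, simp, blast)+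

lemma max_norm1_le_sum: "max_norm1 s m lam mu \<le> 1 + (\<Sum>i=1..s. \<bar>lam i\<bar>) + (\<Sum>j=1..m. \<bar>mu j\<bar>)"
  unfolding max_norm1_def
proof (rule Max.boundedI)
  have lam: "\<bar>lam i\<bar> \<le> (\<Sum>i=1..s. \<bar>lam i\<bar>)" if "i \<in> {1..s}" for i
    using that by (intro member_le_sum) auto
  have mu: "\<bar>mu j\<bar> \<le> (\<Sum>j=1..m. \<bar>mu j\<bar>)" if "j \<in> {1..m}" for j
    using that by (intro member_le_sum) auto
  have nonneg: "(\<Sum>i=1..s. \<bar>lam i\<bar>) \<ge> 0" "(\<Sum>j=1..m. \<bar>mu j\<bar>) \<ge> 0"
    by (auto intro: sum_nonneg)
  fix x assume "x \<in> {1} \<union> (\<lambda>i. \<bar>lam i\<bar>) ` {1..s} \<union> (\<lambda>j. \<bar>mu j\<bar>) ` {1..m}"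
  then consider "x = 1" | i where "i \<in> {1..s}" "x = \<bar>lam i\<bar>" | j where "j \<in> {1..m}" "x = \<bar>mu j\<bar>"
    by blast
  then show "x \<le> 1 + (\<Sum>i=1..s. \<bar>lam i\<bar>) + (\<Sum>j=1..m. \<bar>mu j\<bar>)"
  proof cases
    case 1
    then show ?thesis using nonneg by linarith
  next
    case (2 i)
    then show ?thesis using lam[of i] nonneg by linarith
  next
    case (3 j)
    then show ?thesis using mu[of j] nonneg by linarith
  qed
qed simp_all

lemma unbounded_dual_seq_normalized_limit:
  assumes "\<not> bounded_dual_seq s m lams mus"
  obtains r \<alpha> \<beta> where "strict_mono (r :: nat \<Rightarrow> nat)"
    and "filterlim (\<lambda>k. max_norm1 s m (lams (r k)) (mus (r k))) at_top sequentially"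
    and "\<And>i. i \<in> {1..s} \<Longrightarrow>
      (\<lambda>k. lams (r k) i / max_norm1 s m (lams (r k)) (mus (r k))) \<longlonglongrightarrow> \<alpha> i"
    and "\<And>j. j \<in> {1..m} \<Longrightarrow>
      (\<lambda>k. mus (r k) j / max_norm1 s m (lams (r k)) (mus (r k))) \<longlonglongrightarrow> \<beta> j"
    and "(\<exists>i\<in>{1..s}. \<alpha> i \<noteq> 0) \<or> (\<exists>j\<in>{1..m}. \<beta> j \<noteq> 0)"
proof -
  define \<gamma> where "\<gamma> k = max_norm1 s m (lams k) (mus k)" for k
  have \<gamma>1: "\<gamma> k \<ge> 1" for k by (simp add: \<gamma>_def max_norm1_ge)
  have "\<exists>k. \<gamma> k > B" for B
  proof (rule ccontr)
    assume "\<not> (\<exists>k. \<gamma> k > B)"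
    then have "\<gamma> k \<le> B" for k by (meson not_less)
    then have "bounded_dual_seq s m lams mus"
      unfolding bounded_dual_seq_def \<gamma>_def using max_norm1_ge(2,3) order_trans by metis
    with assms show False ..
  qed
  then obtain r0 :: "nat \<Rightarrow> nat" where r0: "strict_mono r0"
    and \<gamma>r0: "filterlim (\<lambda>k. \<gamma> (r0 k)) at_top sequentially"
    by (rule subsequence_at_top)
  define z where "z k = case_sum (\<lambda>i. lams (r0 k) i / \<gamma> (r0 k)) (\<lambda>j. mus (r0 k) j / \<gamma> (r0 k))" for k
  have "\<bar>z k x\<bar> \<le> 1" if "x \<in> {1..s} <+> {1..m}" for k x
    using that \<gamma>1[of "r0 k"] max_norm1_ge(2,3)[where lam = "lams (r0 k)" and mu = "mus (r0 k)"]
    by (auto simp: z_def \<gamma>_def abs_divide)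
  then obtain r1 l where r1: "strict_mono (r1 :: nat \<Rightarrow> nat)"
    and l: "\<And>x. x \<in> {1..s} <+> {1..m} \<Longrightarrow> (\<lambda>k. z (r1 k) x) \<longlonglongrightarrow> l x"
    using convergent_subsequence_finite_family[of "{1..s} <+> {1..m}" z 1]
    by (metis finite_Plus finite_atLeastAtMost)
  define r where "r = r0 \<circ> r1"
  define \<alpha> where "\<alpha> i = l (Inl i)" for i
  define \<beta> where "\<beta> j = l (Inr j)" for j
  have r: "strict_mono r" unfolding r_def using r0 r1 by (rule strict_mono_o)
  have \<gamma>r: "filterlim (\<lambda>k. \<gamma> (r k)) at_top sequentially"
    using filterlim_compose[OF \<gamma>r0 filterlim_subseq[OF r1]] by (simp add: r_def)
  have \<alpha>: "(\<lambda>k. lams (r k) i / \<gamma> (r k)) \<longlonglongrightarrow> \<alpha> i" if "i \<in> {1..s}" for i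
    using l[OF InlI[OF that]] by (simp add: z_def r_def \<alpha>_def)
  have \<beta>: "(\<lambda>k. mus (r k) j / \<gamma> (r k)) \<longlonglongrightarrow> \<beta> j" if "j \<in> {1..m}" for j
    using l[OF InrI[OF that]] by (simp add: z_def r_def \<beta>_def)
  have inv: "(\<lambda>k. 1 / \<gamma> (r k)) \<longlonglongrightarrow> 0"
    using tendsto_inverse_0_at_top[OF \<gamma>r] by (simp add: divide_inverse)
  (* after normalization the entry 1 vanishes in the limit, so the norm 1 is carried by the
     multipliers *)
  have "(\<lambda>k. 1 / \<gamma> (r k) + (\<Sum>i=1..s. \<bar>lams (r k) i / \<gamma> (r k)\<bar>)
      + (\<Sum>j=1..m. \<bar>mus (r k) j / \<gamma> (r k)\<bar>)) \<longlonglongrightarrow> 0 + (\<Sum>i=1..s. \<bar>\<alpha> i\<bar>) + (\<Sum>j=1..m. \<bar>\<beta> j\<bar>)"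
    by (intro tendsto_add tendsto_sum tendsto_rabs inv \<alpha> \<beta>)
  moreover have "1 \<le> 1 / \<gamma> (r k) + (\<Sum>i=1..s. \<bar>lams (r k) i / \<gamma> (r k)\<bar>)
      + (\<Sum>j=1..m. \<bar>mus (r k) j / \<gamma> (r k)\<bar>)" for k
  proof -
    have pos: "\<gamma> (r k) > 0" using \<gamma>1[of "r k"] by linarith
    have "1 = \<gamma> (r k) / \<gamma> (r k)" using pos by simp
    also have "\<dots> \<le> (1 + (\<Sum>i=1..s. \<bar>lams (r k) i\<bar>) + (\<Sum>j=1..m. \<bar>mus (r k) j\<bar>)) / \<gamma> (r k)"
      using pos max_norm1_le_sum unfolding \<gamma>_def by (intro divide_right_mono) auto
    also have "\<dots> = 1 / \<gamma> (r k) + (\<Sum>i=1..s. \<bar>lams (r k) i / \<gamma> (r k)\<bar>)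
      + (\<Sum>j=1..m. \<bar>mus (r k) j / \<gamma> (r k)\<bar>)"
      using pos by (simp add: add_divide_distrib sum_divide_distrib abs_divide)
    finally show ?thesis .
  qed
  ultimately have "1 \<le> 0 + (\<Sum>i=1..s. \<bar>\<alpha> i\<bar>) + (\<Sum>j=1..m. \<bar>\<beta> j\<bar>)"
    by (intro LIMSEQ_le_const) blast+
  then have "(\<exists>i\<in>{1..s}. \<alpha> i \<noteq> 0) \<or> (\<exists>j\<in>{1..m}. \<beta> j \<noteq> 0)"
    by (rule contrapos_pp) simp
  with r \<gamma>r \<alpha> \<beta> show ?thesis
    unfolding \<gamma>_def by (intro that)
qed


section \<open>Quasinormality bounds the dual sequence\<close>

context riemannian
begin

text \<open>The subsequence clause of \<^const>\<open>PAKKT_point_with\<close> is applied to a subsequence chosen so that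
  the premises of the sign condition hold: the norms tend to infinity and every normalized component
  converges.\<close>

lemma QN_imp_bounded_dual_seq:
  assumes f: "C1_function A f"
    and h: "\<And>i. i \<in> {1..s} \<Longrightarrow> C1_function A (h i)"
    and g: "\<And>j. j \<in> {1..m} \<Longrightarrow> C1_function A (g j)"
    and P: "PAKKT_point_with A G f s h m g p ps lams mus"
    and QN: "QN A G s h m g p"
  shows "bounded_dual_seq s m lams mus"
proof (rule ccontr)
  assume "\<not> bounded_dual_seq s m lams mus"
  then obtain r0 \<alpha> \<beta> where r0: "strict_mono (r0 :: nat \<Rightarrow> nat)"
    and top0: "filterlim (\<lambda>k. max_norm1 s m (lams (r0 k)) (mus (r0 k))) at_top sequentially"
    and \<alpha>0: "\<And>i. i \<in> {1..s} \<Longrightarrow>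
      (\<lambda>k. lams (r0 k) i / max_norm1 s m (lams (r0 k)) (mus (r0 k))) \<longlonglongrightarrow> \<alpha> i"
    and \<beta>0: "\<And>j. j \<in> {1..m} \<Longrightarrow>
      (\<lambda>k. mus (r0 k) j / max_norm1 s m (lams (r0 k)) (mus (r0 k))) \<longlonglongrightarrow> \<beta> j"
    and nonzero: "(\<exists>i\<in>{1..s}. \<alpha> i \<noteq> 0) \<or> (\<exists>j\<in>{1..m}. \<beta> j \<noteq> 0)"
    by (rule unbounded_dual_seq_normalized_limit) blast
  obtain N where sign0: "PAKKT_sign_condition s h m g
      (\<lambda>k. ps (r0 (k + N))) (\<lambda>k. lams (r0 (k + N))) (\<lambda>k. mus (r0 (k + N)))"
    using P r0 unfolding PAKKT_point_with_def by blast
  define r where "r k = r0 (k + N)" for k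
  define \<gamma> where "\<gamma> k = max_norm1 s m (lams (r k)) (mus (r k))" for k
  have \<gamma>pos: "\<gamma> k > 0" for k
    using max_norm1_ge(1)[of s m "lams (r k)" "mus (r k)"] by (simp add: \<gamma>_def)
  have r: "strict_mono r"
    using r0 by (simp add: r_def strict_mono_def)
  have fr: "filterlim r sequentially sequentially"
    using r by (rule filterlim_subseq)
  have top: "filterlim \<gamma> at_top sequentially"
    unfolding \<gamma>_def r_def
    by (rule filterlim_compose[OF top0 filterlim_add_const_nat_at_top])
  have \<alpha>: "(\<lambda>k. lams (r k) i / \<gamma> k) \<longlonglongrightarrow> \<alpha> i" if "i \<in> {1..s}" for i
    unfolding \<gamma>_def r_def using LIMSEQ_ignore_initial_segment[OF \<alpha>0[OF that]] .
  have \<beta>: "(\<lambda>k. mus (r k) j / \<gamma> k) \<longlonglongrightarrow> \<beta> j" if "j \<in> {1..m}" for j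
    unfolding \<gamma>_def r_def using LIMSEQ_ignore_initial_segment[OF \<beta>0[OF that]] .
  have ps: "(\<lambda>k. ps (r k)) \<longlonglongrightarrow> p"
    and grad: "(\<lambda>k. tnorm G (ps (r k))
      (gradient A G (lagrangian f s h m g (lams (r k)) (mus (r k))) (ps (r k)))) \<longlonglongrightarrow> 0"
    using P unfolding PAKKT_point_with_def by (auto intro: filterlim_compose[OF _ fr])
  have nonneg: "mus k j \<ge> 0" if "j \<in> {1..m}" for k j
    using P that unfolding PAKKT_point_with_def by blast
  have "\<forall>\<^sub>F k in sequentially. \<forall>j\<in>{1..m} - active_set m g p. mus k j = 0"
    using P unfolding PAKKT_point_with_def by blast
  then have inactive: "\<forall>\<^sub>F k in sequentially. \<forall>j\<in>{1..m} - active_set m g p. mus (r k) j = 0"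
    using fr by (rule eventually_compose_filterlim)
  have \<beta>_nonneg: "\<beta> j \<ge> 0" if "j \<in> {1..m}" for j
    using \<beta>[OF that]
    by (rule LIMSEQ_le_const) (use nonneg that \<gamma>pos in \<open>auto intro!: exI[of _ 0] divide_nonneg_pos\<close>)
  have \<beta>_inactive: "\<beta> j = 0" if j: "j \<in> {1..m} - active_set m g p" for j
  proof (rule LIMSEQ_unique)
    show "(\<lambda>k. mus (r k) j / \<gamma> k) \<longlonglongrightarrow> \<beta> j" using \<beta> j by blast
    show "(\<lambda>k. mus (r k) j / \<gamma> k) \<longlonglongrightarrow> 0"
      by (rule tendsto_eventually, rule eventually_mono[OF inactive]) (use j in auto)
  qed

  note dh = C1_function_differentiable[OF h] and dg = C1_function_differentiable[OF g]
  have active: "active_set m g p \<subseteq> {1..m}" by (auto simp: active_set_def)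
  have inv: "(\<lambda>k. 1 / \<gamma> k) \<longlonglongrightarrow> 0"
    using tendsto_inverse_0_at_top[OF top] by (simp add: divide_inverse)
  have "(\<Sum>i=1..s. \<alpha> i *\<^sub>T gradient A G (h i) p) +
      (\<Sum>j\<in>active_set m g p. \<beta> j *\<^sub>T gradient A G (g j) p) = 0"
  proof (rule gradient_combination_eq_0)
    fix w assume w: "w \<in> tangent_space A p"
    have "(\<Sum>j\<in>active_set m g p. \<beta> j * differential A (g j) p w) =
        (\<Sum>j=1..m. \<beta> j * differential A (g j) p w)"
      using active \<beta>_inactive by (intro sum.mono_neutral_left) auto
    moreover have "0 * differential A f p w + (\<Sum>i=1..s. \<alpha> i * differential A (h i) p w)
        + (\<Sum>j=1..m. \<beta> j * differential A (g j) p w) = 0"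
      by (rule scaled_stationarity_limit[OF f _ _ ps grad inv _ _ w])
        (use h g \<alpha> \<beta> in simp_all)
    ultimately show "(\<Sum>i=1..s. \<alpha> i * differential A (h i) p w) +
        (\<Sum>j\<in>active_set m g p. \<beta> j * differential A (g j) p w) = 0"
      by simp
  qed (use dh dg active in blast)+
  moreover have "\<exists>q\<in>riem_ball A G p \<epsilon>.
      (\<forall>i\<in>{1..s}. \<alpha> i \<noteq> 0 \<longrightarrow> \<alpha> i * h i q > 0) \<and>
      (\<forall>j\<in>active_set m g p. \<beta> j > 0 \<longrightarrow> \<beta> j * g j q > 0)" if "\<epsilon> > 0" for \<epsilon> :: real
  proof -
    have signh: "lams (r k) i * h i (ps (r k)) > 0" if i: "i \<in> {1..s}" and "\<alpha> i \<noteq> 0" for i k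
    proof -
      have "(\<lambda>k. \<bar>lams (r k) i\<bar> / \<gamma> k) \<longlonglongrightarrow> \<bar>\<alpha> i\<bar>"
        using tendsto_rabs[OF \<alpha>[OF i]] \<gamma>pos by (simp add: abs_divide abs_of_pos)
      moreover have "\<bar>\<alpha> i\<bar> > 0" using that by simp
      ultimately show ?thesis
        using sign0 top i unfolding PAKKT_sign_condition_def Let_def r_def \<gamma>_def by blast
    qed
    have signg: "mus (r k) j * g j (ps (r k)) > 0" if j: "j \<in> {1..m}" and "\<beta> j > 0" for j k
      using sign0 top j \<beta>[OF j] that(2) unfolding PAKKT_sign_condition_def Let_def r_def \<gamma>_def
      by blast
    (* the sign condition speaks of the multipliers, quasinormality of their normalized limits:
       both have the same sign for large k *)
    have "\<forall>\<^sub>F k in sequentially. \<alpha> i \<noteq> 0 \<longrightarrow> \<alpha> i * h i (ps (r k)) > 0" if i: "i \<in> {1..s}" for i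
    proof (cases "\<alpha> i = 0")
      case False
      have "(\<lambda>k. \<alpha> i * (lams (r k) i / \<gamma> k)) \<longlonglongrightarrow> \<alpha> i * \<alpha> i"
        by (intro tendsto_mult tendsto_const \<alpha> i)
      moreover have "\<alpha> i * \<alpha> i > 0" using False not_real_square_gt_zero by blast
      ultimately have "\<forall>\<^sub>F k in sequentially. \<alpha> i * (lams (r k) i / \<gamma> k) > 0"
        by (rule order_tendstoD)
      then show ?thesis
      proof eventually_elim
        case (elim k)
        then have "\<alpha> i * lams (r k) i > 0"
          using \<gamma>pos[of k] by (simp add: zero_less_divide_iff)
        then show ?case
          using signh[OF i False, of k] by (auto simp: zero_less_mult_iff)
      qed
    qed simp
    then have "\<forall>\<^sub>F k in sequentially. \<forall>i\<in>{1..s}. \<alpha> i \<noteq> 0 \<longrightarrow> \<alpha> i * h i (ps (r k)) > 0"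
      by (intro eventually_ball_finite) auto
    with eventually_in_riem_ball[OF ps \<open>\<epsilon> > 0\<close>]
    have "\<forall>\<^sub>F k in sequentially. ps (r k) \<in> riem_ball A G p \<epsilon> \<and>
        (\<forall>i\<in>{1..s}. \<alpha> i \<noteq> 0 \<longrightarrow> \<alpha> i * h i (ps (r k)) > 0)"
      by (rule eventually_conj)
    then obtain k where k: "ps (r k) \<in> riem_ball A G p \<epsilon>"
      "\<forall>i\<in>{1..s}. \<alpha> i \<noteq> 0 \<longrightarrow> \<alpha> i * h i (ps (r k)) > 0"
      by (auto simp: eventually_sequentially)
    have "\<beta> j * g j (ps (r k)) > 0" if "j \<in> active_set m g p" "\<beta> j > 0" for j
    proof -
      have j: "j \<in> {1..m}" using that active by blast
      have "g j (ps (r k)) > 0"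
        using signg[OF j that(2), of k] nonneg[OF j, of "r k"] by (auto simp: zero_less_mult_iff)
      then show ?thesis using that(2) by simp
    qed
    with k show ?thesis by blast
  qed
  ultimately show False
    using QN \<beta>_nonneg \<beta>_inactive nonzero unfolding QN_def by blast
qed

lemma bounded_dual_seq_imp_dual_limit_point:
  assumes "bounded_dual_seq s m lams mus"
  shows "\<exists>lam mu. dual_limit_point s m lams mus lam mu"
proof -
  obtain B where B: "\<And>k. (\<forall>i\<in>{1..s}. \<bar>lams k i\<bar> \<le> B) \<and> (\<forall>j\<in>{1..m}. \<bar>mus k j\<bar> \<le> B)"
    using assms unfolding bounded_dual_seq_def by blast
  define z where "z k = case_sum (lams k) (mus k)" for k
  have "\<bar>z k x\<bar> \<le> B" if "x \<in> {1..s} <+> {1..m}" for k x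
    using that B[of k] by (auto simp: z_def)
  then obtain r l where r: "strict_mono (r :: nat \<Rightarrow> nat)"
    and l: "\<And>x. x \<in> {1..s} <+> {1..m} \<Longrightarrow> (\<lambda>k. z (r k) x) \<longlonglongrightarrow> l x"
    using convergent_subsequence_finite_family[of "{1..s} <+> {1..m}" z B]
    by (metis finite_Plus finite_atLeastAtMost)
  have "(\<lambda>k. lams (r k) i) \<longlonglongrightarrow> l (Inl i)" if "i \<in> {1..s}" for i
    using l[OF InlI[OF that]] by (simp add: z_def)
  moreover have "(\<lambda>k. mus (r k) j) \<longlonglongrightarrow> l (Inr j)" if "j \<in> {1..m}" for j
    using l[OF InrI[OF that]] by (simp add: z_def)
  ultimately have "dual_limit_point s m lams mus (\<lambda>i. l (Inl i)) (\<lambda>j. l (Inr j))"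
    unfolding dual_limit_point_def using r by blast
  then show ?thesis by blast
qed

end

theorem theorem4p2:
  fixes A :: "('a::{t2_space, second_countable_topology}, 'n::finite) chart set"
    and G :: "('a, 'n) metric_field"
    and f :: "'a \<Rightarrow> real"
    and s m :: nat
    and h g :: "nat \<Rightarrow> 'a \<Rightarrow> real"
    and p :: 'a
    and ps :: "nat \<Rightarrow> 'a"
    and lams mus :: "nat \<Rightarrow> nat \<Rightarrow> real"
  assumes "complete_riemannian_manifold A G"
    and "C1_function A f"
    and "\<And>i. i \<in> {1..s} \<Longrightarrow> C1_function A (h i)"
    and "\<And>j. j \<in> {1..m} \<Longrightarrow> C1_function A (g j)"
    and "PAKKT_point_with A G f s h m g p ps lams mus"
    and "QN A G s h m g p"
  shows "bounded_dual_seq s m lams mus \<and>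
    KKT A G f s h m g p \<and>
    (\<forall>lam mu. dual_limit_point s m lams mus lam mu \<longrightarrow> lagrange_multiplier A G f s h m g p lam mu)"
proof -
  interpret riemannian A G
    using assms(1) by unfold_locales (simp_all add: complete_riemannian_manifold_def)
  have bounded: "bounded_dual_seq s m lams mus"
    using assms(2-6) by (rule QN_imp_bounded_dual_seq)
  have multiplier: "lagrange_multiplier A G f s h m g p lam mu"
    if "dual_limit_point s m lams mus lam mu" for lam mu
    using assms(2-5) that by (rule dual_limit_point_is_multiplier)
  have "KKT A G f s h m g p"
    unfolding KKT_def
    using assms(5) multiplier bounded_dual_seq_imp_dual_limit_point[OF bounded]
    unfolding PAKKT_point_with_def by blast
  with bounded multiplier show ?thesis by blast
qed

end
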